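(* Let $f$ be the germ at the origin of a real-analytic planar map, having an elliptic fixed point at the origin with rational rotation number $\omega_0=\frac{p}{q}\in(0,\tfrac12)$, $\gcd(p,q)=1$, $q\ge3$, and suppose $f$ admits a real-analytic first integral $I_1$, defined in a neighbourhood $U$ of the origin, with a non-degenerate local minimum at $(0,0)$. If $f$ admits a second first integral $I_2\in C^\infty(U)$ whose Taylor series at the origin, in normal form coordinates $w=re^{i\theta}$, does not depend only on $r^2$ (i.e. is not a formal power series in $r^2=w\bar w$), then $f$ is real-analytically conjugate to its linear part.
   Context: A real-analytic planar map germ $f$ with $f(0,0)=(0,0)$ has an elliptic fixed point at the origin with rotation number $\omega_0\in(0,\tfrac12)$ if the eigenvalues of its linear part $L=d_{(0,0)}f$ are $\mu=e^{i2\pi\omega_0}$ and $\bar\mu$. The plane is identified with $\mathbb{C}$ via $z=x+iy$, and it is assumed that in this coordinate $L(z)=\mu z$. A first integral of $f$ is a function $I$ defined in a neighbourhood of the origin with $I\circ f=I$ near the origin. A non-degenerate local minimum at $(0,0)$ means a critical point there with positive definite Hessian. Normal form coordinates are real-analytic local coordinates $w=re^{i\theta}$ centred at the origin in which $f$ takes the form $(r,\theta)\mapsto(r,\theta+\Xi(r,\theta))$, with $\Xi$ real-analytic, $2\pi/q$-periodic in $\theta$, $\Xi(0,\theta)=2\pi p/q$, and in which $I_1$ assumes the form $r^2=|w|^2$ (up to an additive constant). Two germs $f,g$ fixing the origin are real-analytically conjugate if there is a germ of real-analytic diffeomorphism $\phi$ fixing the origin with $\phi^{-1}\circ f\circ\phi=g$.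 *)

theory Defs
  imports "HOL-Analysis.Analysis"
begin

text \<open>
  The real plane is the type \<^typ>\<open>complex\<close>, with \<open>z = x + \<i> y\<close>; all derivatives are real (Frechet)
  derivatives. A germ at the origin is represented by a total function whose values away from
  the origin are irrelevant; \<open>\<forall>\<^sub>F z in nhds 0\<close> expresses equality of germs.
\<close>

definition real_analytic2_at ::
    "(real \<Rightarrow> real \<Rightarrow> 'b::real_normed_vector) \<Rightarrow> real \<Rightarrow> real \<Rightarrow> bool" where
  "real_analytic2_at F x0 y0 \<longleftrightarrow>
     (\<exists>a :: nat \<Rightarrow> nat \<Rightarrow> 'b. \<exists>\<rho>>0. \<forall>x y. \<bar>x\<bar> < \<rho> \<and> \<bar>y\<bar> < \<rho> \<longrightarrow>
        ((\<lambda>(i, j). (x ^ i * y ^ j) *\<^sub>R a i j) has_sum F (x0 + x) (y0 + y)) UNIV)"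

definition real_analytic_at :: "(complex \<Rightarrow> 'b::real_normed_vector) \<Rightarrow> complex \<Rightarrow> bool" where
  "real_analytic_at F z \<longleftrightarrow> real_analytic2_at (\<lambda>x y. F (Complex x y)) (Re z) (Im z)"

primrec Ck_on :: "nat \<Rightarrow> (complex \<Rightarrow> real) \<Rightarrow> complex set \<Rightarrow> bool" where
  "Ck_on 0 F U \<longleftrightarrow> continuous_on U F"
| "Ck_on (Suc k) F U \<longleftrightarrow>
     (\<forall>z\<in>U. F differentiable (at z)) \<and> (\<forall>v. Ck_on k (\<lambda>z. frechet_derivative F (at z) v) U)"

definition smooth_on :: "(complex \<Rightarrow> real) \<Rightarrow> complex set \<Rightarrow> bool" where
  "smooth_on F U \<longleftrightarrow> (\<forall>k. Ck_on k F U)"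

definition dir_deriv :: "complex \<Rightarrow> (complex \<Rightarrow> real) \<Rightarrow> complex \<Rightarrow> real" where
  "dir_deriv v F = (\<lambda>z. frechet_derivative F (at z) v)"

definition partial_deriv :: "nat \<Rightarrow> nat \<Rightarrow> (complex \<Rightarrow> real) \<Rightarrow> complex \<Rightarrow> real" where
  "partial_deriv i j F = (dir_deriv 1 ^^ i) ((dir_deriv \<i> ^^ j) F)"

definition taylor_coeff :: "(complex \<Rightarrow> real) \<Rightarrow> nat \<Rightarrow> nat \<Rightarrow> real" where
  "taylor_coeff F i j = partial_deriv i j F 0 / (fact i * fact j)"

text \<open>
  The Taylor series at the origin equals a formal power series \<open>\<Sum>n. b n * (r\<^sup>2)^n\<close>,
  with \<open>r\<^sup>2 = u\<^sup>2 + v\<^sup>2\<close> in the coordinate \<open>w = u + \<i> v\<close>. No convergence is involved: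
  the homogeneous components of each degree \<open>N\<close> are compared, as polynomials in \<open>u\<close> and \<open>v\<close>.
\<close>
definition taylor_series_in_r2 :: "(complex \<Rightarrow> real) \<Rightarrow> bool" where
  "taylor_series_in_r2 F \<longleftrightarrow>
     (\<exists>b :: nat \<Rightarrow> real. \<forall>N u v.
        (\<Sum>i\<le>N. taylor_coeff F i (N - i) * u ^ i * v ^ (N - i)) =
        (if even N then b (N div 2) * (u\<^sup>2 + v\<^sup>2) ^ (N div 2) else 0))"

definition nondegenerate_local_min :: "(complex \<Rightarrow> real) \<Rightarrow> bool" where
  "nondegenerate_local_min F \<longleftrightarrow>
     (F has_derivative (\<lambda>_. 0)) (at 0) \<and>
     (\<forall>u v. (u, v) \<noteq> (0, 0) \<longrightarrow>
        partial_deriv 2 0 F 0 * u\<^sup>2 + 2 * partial_deriv 1 1 F 0 * u * v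
          + partial_deriv 0 2 F 0 * v\<^sup>2 > 0)"

abbreviation linear_part :: "(complex \<Rightarrow> complex) \<Rightarrow> complex \<Rightarrow> complex" where
  "linear_part f \<equiv> frechet_derivative f (at 0)"

text \<open>
  Complex eigenvalues of a real-linear map \<open>L\<close> of the plane: \<open>(a, b)\<close> is an eigenvector of the
  complexified matrix of \<open>L\<close> with respect to the real basis \<open>1, \<i>\<close>.
\<close>
definition plane_eigenvalues :: "(complex \<Rightarrow> complex) \<Rightarrow> complex set" where
  "plane_eigenvalues L =
     {l. \<exists>a b. (a, b) \<noteq> (0, 0) \<and>
         of_real (Re (L 1)) * a + of_real (Re (L \<i>)) * b = l * a \<and>
         of_real (Im (L 1)) * a + of_real (Im (L \<i>)) * b = l * b}"

definition elliptic_fixed_point :: "(complex \<Rightarrow> complex) \<Rightarrow> real \<Rightarrow> bool" where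
  "elliptic_fixed_point f \<omega> \<longleftrightarrow>
     f 0 = 0 \<and> 0 < \<omega> \<and> \<omega> < 1/2 \<and> f differentiable (at 0) \<and>
     plane_eigenvalues (linear_part f) = {cis (2 * pi * \<omega>), cnj (cis (2 * pi * \<omega>))}"

definition first_integral :: "(complex \<Rightarrow> complex) \<Rightarrow> (complex \<Rightarrow> real) \<Rightarrow> bool" where
  "first_integral f I \<longleftrightarrow> (\<forall>\<^sub>F z in nhds 0. I (f z) = I z)"

text \<open>\<open>\<phi>\<close> is a germ of real-analytic diffeomorphism fixing the origin, with inverse germ \<open>\<psi>\<close>.\<close>
definition analytic_diffeo_germ :: "(complex \<Rightarrow> complex) \<Rightarrow> (complex \<Rightarrow> complex) \<Rightarrow> bool" where
  "analytic_diffeo_germ \<phi> \<psi> \<longleftrightarrow>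
     \<phi> 0 = 0 \<and> \<psi> 0 = 0 \<and> real_analytic_at \<phi> 0 \<and> real_analytic_at \<psi> 0 \<and>
     (\<forall>\<^sub>F z in nhds 0. \<psi> (\<phi> z) = z) \<and> (\<forall>\<^sub>F z in nhds 0. \<phi> (\<psi> z) = z)"

definition analytically_conjugate :: "(complex \<Rightarrow> complex) \<Rightarrow> (complex \<Rightarrow> complex) \<Rightarrow> bool" where
  "analytically_conjugate f g \<longleftrightarrow>
     (\<exists>\<phi> \<psi>. analytic_diffeo_germ \<phi> \<psi> \<and> (\<forall>\<^sub>F z in nhds 0. \<psi> (f (\<phi> z)) = g z))"

text \<open>
  The chart \<open>W\<close> sends a point \<open>z\<close> to its coordinate \<open>w\<close>, and \<open>V\<close> is its inverse. Analyticity of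
  \<open>\<Xi>\<close> up to and including \<open>r = 0\<close> is expressed on the two-sided interval \<open>\<bar>r\<bar> < \<rho>\<close>;
  the polar form of the map is required for \<open>r \<ge> 0\<close>.
\<close>
definition normal_form_coordinates ::
    "(complex \<Rightarrow> complex) \<Rightarrow> (complex \<Rightarrow> real) \<Rightarrow> nat \<Rightarrow> nat \<Rightarrow>
     (complex \<Rightarrow> complex) \<Rightarrow> (complex \<Rightarrow> complex) \<Rightarrow> bool" where
  "normal_form_coordinates f I p q W V \<longleftrightarrow>
     analytic_diffeo_germ W V \<and>
     (\<exists>\<rho>>0. \<exists>\<Xi> :: real \<Rightarrow> real \<Rightarrow> real.
        (\<forall>r \<theta>. \<bar>r\<bar> < \<rho> \<longrightarrow> real_analytic2_at \<Xi> r \<theta>) \<and>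
        (\<forall>r \<theta>. \<bar>r\<bar> < \<rho> \<longrightarrow> \<Xi> r (\<theta> + 2 * pi / real q) = \<Xi> r \<theta>) \<and>
        (\<forall>\<theta>. \<Xi> 0 \<theta> = 2 * pi * real p / real q) \<and>
        (\<forall>r \<theta>. 0 \<le> r \<and> r < \<rho> \<longrightarrow>
           W (f (V (of_real r * cis \<theta>))) = of_real r * cis (\<theta> + \<Xi> r \<theta>))) \<and>
     (\<exists>c. \<forall>\<^sub>F w in nhds 0. I (V w) = c + (cmod w)\<^sup>2)"

end

theory Submission
  imports Defs "HOL-Complex_Analysis.Cauchy_Integral_Formula"
begin

text \<open>
  In normal form coordinates \<open>F = I2 \<circ> V\<close> is invariant under \<open>(r, \<theta>) \<mapsto> (r, \<theta> + \<Xi> r \<theta>)\<close>. Let \<open>r^N P(\<theta>)\<close>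
  be its first homogeneous Taylor component that is not a function of \<open>r\<close> alone; comparing leading
  terms gives \<open>P(\<theta> + \<alpha>) = P(\<theta>)\<close> for \<open>\<alpha> = 2\<pi>p/q\<close>. Let \<open>\<Phi>\<close> be the sum of \<open>F\<close> over the rotations by
  multiples of \<open>\<alpha>\<close>. As \<open>\<Xi>\<close> is \<open>\<alpha>\<close>-periodic, \<open>\<Phi>\<close> takes the same value at \<open>(r, \<theta>)\<close> and at
  \<open>(r, \<theta> + \<Xi> r \<theta> - \<alpha>)\<close>, so by Rolle's theorem \<open>\<partial>\<Phi>/\<partial>\<theta> = q r^N P'(\<theta>) + O(r^(N+1))\<close> vanishes in between
  unless \<open>\<Xi> r \<theta> = \<alpha>\<close>. Near an angle where \<open>P'\<close> is nonzero this forces \<open>\<Xi> r \<theta> = \<alpha>\<close> for all small \<open>r\<close>,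
  and by the identity theorem in \<open>\<theta>\<close> it holds for every angle: in the coordinate \<open>w\<close> the map
  is the rotation by \<open>\<alpha>\<close>.
\<close>

section \<open>Calculus of smooth functions on the plane\<close>

lemma linear_complex_split:
  fixes D :: "complex \<Rightarrow> real"
  assumes "linear D"
  shows "D h = Re h * D 1 + Im h * D \<i>"
proof -
  have "D h = D (Re h *\<^sub>R 1 + Im h *\<^sub>R \<i>)"
    by (rule arg_cong[of _ _ D]) (simp add: complex_eq_iff)
  also have "\<dots> = Re h * D 1 + Im h * D \<i>"
    using assms by (simp add: linear_add linear_cmul)
  finally show ?thesis .
qed

lemma has_derivative_dir_deriv:
  assumes "F differentiable (at z)"
  shows "(F has_derivative (\<lambda>h. Re h * dir_deriv 1 F z + Im h * dir_deriv \<i> F z)) (at z)"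
proof -
  have d: "(F has_derivative frechet_derivative F (at z)) (at z)"
    using assms frechet_derivative_works by blast
  have "frechet_derivative F (at z) = (\<lambda>h. Re h * dir_deriv 1 F z + Im h * dir_deriv \<i> F z)"
    unfolding dir_deriv_def using linear_complex_split[OF has_derivative_linear[OF d]] by blast
  with d show ?thesis by simp
qed

lemma dir_deriv_eq:
  assumes "(F has_derivative D) (at z)"
  shows "dir_deriv v F z = D v"
  unfolding dir_deriv_def using frechet_derivative_at[OF assms] by simp

text \<open>\<open>frechet_derivative\<close> is a choice from the set of derivatives, and functions
  that agree near a point have the same derivatives there; so the choices agree even where neither
  function is differentiable.\<close>

lemma dir_deriv_cong:
  assumes "open S" "z \<in> S" "\<And>w. w \<in> S \<Longrightarrow> F w = G w"
  shows "dir_deriv v F z = dir_deriv v G z"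
proof -
  have "(F has_derivative D) (at z) \<longleftrightarrow> (G has_derivative D) (at z)" for D
    using has_derivative_transform_within_open[of F D z UNIV S G]
      has_derivative_transform_within_open[of G D z UNIV S F] assms by auto
  then show ?thesis
    unfolding dir_deriv_def frechet_derivative_def by simp
qed

section \<open>Stability of the classes C^k under algebra and composition\<close>

lemma Ck_on_cong:
  assumes "open S" "\<And>z. z \<in> S \<Longrightarrow> F z = G z" "Ck_on k F S"
  shows "Ck_on k G S"
  using assms
proof (induction k arbitrary: F G)
  case 0
  then show ?case using continuous_on_eq by (metis Ck_on.simps(1))
next
  case (Suc k)
  have "G differentiable (at z)" if "z \<in> S" for z
  proof -
    have "(F has_derivative frechet_derivative F (at z)) (at z)"
      using Suc.prems(3) that frechet_derivative_works by auto
    then have "(G has_derivative frechet_derivative F (at z)) (at z)"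
      using has_derivative_transform_within_open[OF _ Suc.prems(1) that, of F _ UNIV G] Suc.prems(2)
      by auto
    then show ?thesis unfolding differentiable_def by blast
  qed
  moreover have "Ck_on k (\<lambda>z. frechet_derivative G (at z) v) S" for v
  proof (rule Suc.IH[OF Suc.prems(1)])
    show "frechet_derivative F (at z) v = frechet_derivative G (at z) v" if "z \<in> S" for z
      using dir_deriv_cong[OF Suc.prems(1) that Suc.prems(2), where v = v] by (simp add: dir_deriv_def)
  qed (use Suc.prems(3) in auto)
  ultimately show ?case by simp
qed

text \<open>\<open>Ck_on\<close> speaks of the chosen \<open>frechet_derivative\<close>; this rule
  lets inductions work with an explicit formula \<open>D\<close> instead.\<close>

lemma Ck_on_SucI:
  assumes "open S" "\<And>z. z \<in> S \<Longrightarrow> (F has_derivative D z) (at z)"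
    and "\<And>v. Ck_on k (\<lambda>z. D z v) S"
  shows "Ck_on (Suc k) F S"
proof -
  have "Ck_on k (\<lambda>z. frechet_derivative F (at z) v) S" for v
    by (rule Ck_on_cong[OF assms(1) _ assms(3)[of v]])
      (use frechet_derivative_at[OF assms(2)] in simp)
  then show ?thesis using assms(2) by (auto simp: differentiable_def)
qed

lemma Ck_on_Suc_dir_deriv: "Ck_on (Suc k) F S \<Longrightarrow> Ck_on k (dir_deriv v F) S"
  by (simp add: dir_deriv_def)

lemma Ck_on_SucD:
  assumes "open S" "Ck_on (Suc k) F S"
  shows "Ck_on k F S"
  using assms(2)
proof (induction k arbitrary: F)
  case 0
  then show ?case
    by (auto intro!: continuous_at_imp_continuous_on differentiable_imp_continuous_within)
next
  case (Suc k)
  then show ?case by simp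
qed

lemma Ck_on_subset:
  assumes "T \<subseteq> S" "Ck_on k F S"
  shows "Ck_on k F T"
  using assms(2)
proof (induction k arbitrary: F)
  case 0
  then show ?case using assms(1) continuous_on_subset by auto
next
  case (Suc k)
  then show ?case using assms(1) by auto
qed

lemma Ck_on_const:
  assumes "open S"
  shows "Ck_on k (\<lambda>_. c) S"
proof (induction k arbitrary: c)
  case (Suc k)
  show ?case by (rule Ck_on_SucI[OF assms has_derivative_const Suc.IH])
qed simp

lemma Ck_on_add:
  assumes "open S" "Ck_on k F S" "Ck_on k G S"
  shows "Ck_on k (\<lambda>z. F z + G z) S"
  using assms(2,3)
proof (induction k arbitrary: F G)
  case 0
  then show ?case by (auto intro: continuous_intros)
next
  case (Suc k)
  show ?case
  proof (rule Ck_on_SucI[OF assms(1)])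
    show "((\<lambda>z. F z + G z) has_derivative
        (\<lambda>v. frechet_derivative F (at z) v + frechet_derivative G (at z) v)) (at z)" if "z \<in> S" for z
      using Suc.prems that by (intro has_derivative_add) (auto simp: frechet_derivative_works[symmetric])
  qed (use Suc in auto)
qed

lemma Ck_on_mult:
  assumes "open S" "Ck_on k F S" "Ck_on k G S"
  shows "Ck_on k (\<lambda>z. F z * G z) S"
  using assms(2,3)
proof (induction k arbitrary: F G)
  case 0
  then show ?case by (auto intro: continuous_intros)
next
  case (Suc k)
  show ?case
  proof (rule Ck_on_SucI[OF assms(1)])
    show "((\<lambda>z. F z * G z) has_derivative
        (\<lambda>v. F z * frechet_derivative G (at z) v + frechet_derivative F (at z) v * G z)) (at z)"
      if "z \<in> S" for z
      using Suc.prems that by (intro has_derivative_mult) (auto simp: frechet_derivative_works[symmetric])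
    show "Ck_on k (\<lambda>z. F z * frechet_derivative G (at z) v + frechet_derivative F (at z) v * G z) S" for v
    proof (intro Ck_on_add[OF assms(1)] Suc.IH)
      show "Ck_on k F S" "Ck_on k G S" using Suc.prems Ck_on_SucD[OF assms(1)] by blast+
    qed (use Suc.prems in simp_all)
  qed
qed

text \<open>\<open>Ck_on\<close> concerns real-valued functions, so the inner map enters through its
  real and imaginary parts. The chain rule writes each directional derivative as a sum of products
  of derivatives of these parts with partial derivatives of \<open>F\<close> composed with
  \<open>V\<close>, which allows induction on \<open>k\<close> with \<open>F\<close>
  varying.\<close>

lemma Ck_on_compose:
  fixes V :: "complex \<Rightarrow> complex"
  assumes "open S" "open T" "\<And>z. z \<in> S \<Longrightarrow> V z \<in> T"
    and "Ck_on k F T" "Ck_on k (\<lambda>z. Re (V z)) S" "Ck_on k (\<lambda>z. Im (V z)) S"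
  shows "Ck_on k (\<lambda>z. F (V z)) S"
  using assms(4-6)
proof (induction k arbitrary: F)
  case 0
  have "continuous_on S (\<lambda>z. of_real (Re (V z)) + \<i> * of_real (Im (V z)))"
    using 0 by (auto intro!: continuous_intros)
  then have "continuous_on S V" by (simp add: complex_eq[symmetric])
  then show ?case using 0 assms(3)
    by (auto intro: continuous_on_compose2)
next
  case (Suc k)
  let ?P = "\<lambda>z. Re (V z)" and ?Q = "\<lambda>z. Im (V z)"
  show ?case
  proof (rule Ck_on_SucI[OF assms(1)])
    fix z assume z: "z \<in> S"
    have P: "(?P has_derivative frechet_derivative ?P (at z)) (at z)"
      and Q: "(?Q has_derivative frechet_derivative ?Q (at z)) (at z)"
      using Suc.prems z by (auto simp: frechet_derivative_works[symmetric])
    have V: "(V has_derivative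
        (\<lambda>h. Complex (frechet_derivative ?P (at z) h) (frechet_derivative ?Q (at z) h))) (at z)"
      by (subst has_derivative_componentwise_within) (use P Q in \<open>auto simp: Basis_complex_def inner_complex_def\<close>)
    have F: "(F has_derivative (\<lambda>h. Re h * dir_deriv 1 F (V z) + Im h * dir_deriv \<i> F (V z))) (at (V z))"
      using Suc.prems(1) assms(3)[OF z] by (intro has_derivative_dir_deriv) auto
    show "((\<lambda>z. F (V z)) has_derivative
        (\<lambda>h. frechet_derivative ?P (at z) h * dir_deriv 1 F (V z)
           + frechet_derivative ?Q (at z) h * dir_deriv \<i> F (V z))) (at z)"
      using has_derivative_compose[OF V F] by simp
  next
    have PQ: "Ck_on k ?P S" "Ck_on k ?Q S" using Suc.prems Ck_on_SucD[OF assms(1)] by blast+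
    have "Ck_on k (\<lambda>z. dir_deriv w F (V z)) S" for w
      by (rule Suc.IH[OF Ck_on_Suc_dir_deriv[OF Suc.prems(1)] PQ])
    moreover have "Ck_on k (\<lambda>z. frechet_derivative ?P (at z) v) S"
      "Ck_on k (\<lambda>z. frechet_derivative ?Q (at z) v) S" for v
      using Suc.prems by simp_all
    ultimately show "Ck_on k (\<lambda>z. frechet_derivative ?P (at z) v * dir_deriv 1 F (V z)
           + frechet_derivative ?Q (at z) v * dir_deriv \<i> F (V z)) S" for v
      by (intro Ck_on_add[OF assms(1)] Ck_on_mult[OF assms(1)])
  qed
qed

lemma smooth_on_differentiable: "smooth_on F S \<Longrightarrow> z \<in> S \<Longrightarrow> F differentiable (at z)"
  using Ck_on.simps(2) unfolding smooth_on_def by blast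

lemma smooth_on_dir_deriv: "smooth_on F S \<Longrightarrow> smooth_on (dir_deriv v F) S"
  using Ck_on_Suc_dir_deriv unfolding smooth_on_def by blast

lemma smooth_on_continuous_on: "smooth_on F S \<Longrightarrow> continuous_on S F"
  unfolding smooth_on_def by (metis Ck_on.simps(1))

lemma smooth_on_subset: "T \<subseteq> S \<Longrightarrow> smooth_on F S \<Longrightarrow> smooth_on F T"
  using Ck_on_subset unfolding smooth_on_def by blast

lemma smooth_on_compose:
  assumes "open S" "open T" "\<And>z. z \<in> S \<Longrightarrow> V z \<in> T"
    and "smooth_on F T" "smooth_on (\<lambda>z. Re (V z)) S" "smooth_on (\<lambda>z. Im (V z)) S"
  shows "smooth_on (\<lambda>z. F (V z)) S"
  using assms Ck_on_compose unfolding smooth_on_def by blast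

section \<open>Taylor expansion\<close>

lemma has_real_derivative_line:
  assumes "F differentiable (at (p + of_real s * u))"
  shows "((\<lambda>s. F (p + of_real s * u)) has_real_derivative dir_deriv u F (p + of_real s * u)) (at s)"
proof -
  let ?D = "frechet_derivative F (at (p + of_real s * u))"
  have F: "(F has_derivative ?D) (at (p + of_real s * u))"
    using assms frechet_derivative_works by blast
  have "((\<lambda>s. p + of_real s * u) has_derivative (\<lambda>h. of_real h * u)) (at s)"
    by (auto intro!: derivative_eq_intros)
  then have "((\<lambda>s. F (p + of_real s * u)) has_derivative (\<lambda>h. ?D (of_real h * u))) (at s)"
    using has_derivative_compose F by blast
  moreover have "?D (of_real h * u) = dir_deriv u F (p + of_real s * u) * h" for h
    using linear_cmul[OF has_derivative_linear[OF F], of h u] by (simp add: dir_deriv_def scaleR_conv_of_real)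
  ultimately show ?thesis by (simp add: has_field_derivative_def)
qed

text \<open>The mean value theorem is applied twice: in direction \<open>u\<close> to the difference
  \<open>\<phi>\<close> of \<open>F\<close> on two opposite edges of the parallelogram, then in
  direction \<open>v\<close> to \<open>dir_deriv u F\<close>.\<close>

lemma second_difference_mvt:
  assumes S: "\<And>s t. 0 \<le> s \<Longrightarrow> s \<le> h \<Longrightarrow> 0 \<le> t \<Longrightarrow> t \<le> h \<Longrightarrow> z + of_real s * u + of_real t * v \<in> S"
    and F: "smooth_on F S" and h: "h > 0"
  shows "\<exists>s t. 0 < s \<and> s < h \<and> 0 < t \<and> t < h \<and>
    F (z + of_real h * u + of_real h * v) - F (z + of_real h * u) - F (z + of_real h * v) + F z
      = h\<^sup>2 * dir_deriv v (dir_deriv u F) (z + of_real s * u + of_real t * v)"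
proof -
  define \<phi> where "\<phi> s = F ((z + of_real h * v) + of_real s * u) - F (z + of_real s * u)" for s
  define \<phi>' where "\<phi>' s = dir_deriv u F ((z + of_real h * v) + of_real s * u)
    - dir_deriv u F (z + of_real s * u)" for s
  have "(\<phi> has_real_derivative \<phi>' s) (at s)" if "0 \<le> s" "s \<le> h" for s
    unfolding \<phi>_def \<phi>'_def
    using S[OF that, of h] S[OF that, of 0] h
    by (intro DERIV_diff has_real_derivative_line smooth_on_differentiable[OF F]) (auto simp: algebra_simps)
  then obtain s where s: "0 < s" "s < h" "\<phi> h - \<phi> 0 = (h - 0) * \<phi>' s"
    using MVT2[OF h, of \<phi> \<phi>'] by auto
  define \<psi> where "\<psi> t = dir_deriv u F ((z + of_real s * u) + of_real t * v)" for t
  have "(\<psi> has_real_derivative dir_deriv v (dir_deriv u F) ((z + of_real s * u) + of_real t * v)) (at t)"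
    if "0 \<le> t" "t \<le> h" for t
    unfolding \<psi>_def using S[of s t] s that
    by (intro has_real_derivative_line smooth_on_differentiable[OF smooth_on_dir_deriv[OF F]]) auto
  then obtain t where t: "0 < t" "t < h"
    "\<psi> h - \<psi> 0 = (h - 0) * dir_deriv v (dir_deriv u F) ((z + of_real s * u) + of_real t * v)"
    using MVT2[OF h, of \<psi> "\<lambda>t. dir_deriv v (dir_deriv u F) ((z + of_real s * u) + of_real t * v)"] by auto
  have "\<phi>' s = \<psi> h - \<psi> 0" by (simp add: \<phi>'_def \<psi>_def add_ac)
  with s t show ?thesis
    by (intro exI[of _ s] exI[of _ t]) (simp add: \<phi>_def power2_eq_square add_ac algebra_simps)
qed

text \<open>Schwarz's theorem. The second difference over a small parallelogram is symmetric in
  \<open>u\<close> and \<open>v\<close>, so the two mixed derivatives share a value, attained at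
  possibly different points near \<open>z\<close>; continuity forces equality at
  \<open>z\<close>.\<close>

lemma dir_deriv_commute:
  assumes "open S" "z \<in> S" and F: "smooth_on F S"
  shows "dir_deriv v (dir_deriv u F) z = dir_deriv u (dir_deriv v F) z"
proof (rule ccontr)
  define A where "A = dir_deriv v (dir_deriv u F)"
  define B where "B = dir_deriv u (dir_deriv v F)"
  define e where "e = \<bar>A z - B z\<bar> / 2"
  assume "dir_deriv v (dir_deriv u F) z \<noteq> dir_deriv u (dir_deriv v F) z"
  then have e: "e > 0" by (simp add: e_def A_def B_def)
  have "continuous_on S A" "continuous_on S B"
    unfolding A_def B_def by (intro smooth_on_continuous_on smooth_on_dir_deriv F)+
  then have "isCont A z" "isCont B z"
    using assms(1,2) by (simp_all add: continuous_on_eq_continuous_at)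
  then obtain d1 d2 where d: "d1 > 0" "d2 > 0"
    and A: "\<And>w. dist w z < d1 \<Longrightarrow> dist (A w) (A z) < e"
    and B: "\<And>w. dist w z < d2 \<Longrightarrow> dist (B w) (B z) < e"
    using e unfolding continuous_at by (metis LIM_eq UNIV_I continuous_at continuous_at_eps_delta)
  obtain d3 where d3: "d3 > 0" "ball z d3 \<subseteq> S" using assms(1,2) openE by blast
  \<comment> \<open>The side \<open>h\<close> is scaled by the lengths of \<open>u\<close> and
    \<open>v\<close> so that the whole parallelogram stays within distance \<open>d\<close> of
    \<open>z\<close>; the summand 1 keeps the denominator positive.\<close>
  define d where "d = min d1 (min d2 d3)"
  define h where "h = d / (1 + cmod u + cmod v)"
  have pos: "1 + cmod u + cmod v > 0" by (simp add: add_pos_nonneg)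
  have h: "h > 0" using d d3 pos by (simp add: h_def d_def)
  have near: "dist (z + of_real s * u + of_real t * v) z < d" if "0 \<le> s" "s \<le> h" "0 \<le> t" "t \<le> h" for s t
  proof -
    have "dist (z + of_real s * u + of_real t * v) z = cmod (of_real s * u + of_real t * v)"
      by (simp add: dist_norm)
    also have "\<dots> \<le> s * cmod u + t * cmod v"
      using that by (intro order_trans[OF norm_triangle_ineq]) (simp add: norm_mult)
    also have "\<dots> \<le> h * cmod u + h * cmod v"
      using that by (intro add_mono mult_right_mono) auto
    also have "\<dots> < h * (1 + cmod u + cmod v)" using h by (simp add: algebra_simps)
    also have "\<dots> = d" using pos by (simp add: h_def)
    finally show ?thesis .
  qed
  have inS: "z + of_real s * u + of_real t * v \<in> S" if "0 \<le> s" "s \<le> h" "0 \<le> t" "t \<le> h" for s t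
    using near[OF that] d3 by (auto simp: d_def dist_commute)
  have inS': "z + of_real s * v + of_real t * u \<in> S" if "0 \<le> s" "s \<le> h" "0 \<le> t" "t \<le> h" for s t
    using inS[OF that(3,4,1,2)] by (simp add: add_ac)
  obtain s t where st: "0 < s" "s < h" "0 < t" "t < h" and
    1: "F (z + of_real h * u + of_real h * v) - F (z + of_real h * u) - F (z + of_real h * v) + F z
      = h\<^sup>2 * A (z + of_real s * u + of_real t * v)"
    using second_difference_mvt[OF inS F h] unfolding A_def by blast
  obtain s' t' where st': "0 < s'" "s' < h" "0 < t'" "t' < h" and
    2: "F (z + of_real h * v + of_real h * u) - F (z + of_real h * v) - F (z + of_real h * u) + F z
      = h\<^sup>2 * B (z + of_real s' * v + of_real t' * u)"
    using second_difference_mvt[OF inS' F h] unfolding B_def by blast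
  have comm: "z + of_real s' * v + of_real t' * u = z + of_real t' * u + of_real s' * v"
    "z + of_real h * v + of_real h * u = z + of_real h * u + of_real h * v" by simp_all
  have "h\<^sup>2 * A (z + of_real s * u + of_real t * v) = h\<^sup>2 * B (z + of_real t' * u + of_real s' * v)"
    using 1 2 unfolding comm by linarith
  then have "A (z + of_real s * u + of_real t * v) = B (z + of_real t' * u + of_real s' * v)"
    using h by simp
  moreover have "dist (A (z + of_real s * u + of_real t * v)) (A z) < e"
    using near[of s t] st by (intro A) (simp add: d_def)
  moreover have "dist (B (z + of_real t' * u + of_real s' * v)) (B z) < e"
    using near[of t' s'] st' by (intro B) (simp add: d_def)
  moreover have "\<bar>a - b\<bar> \<le> \<bar>x - a\<bar> + \<bar>x - b\<bar>" for a b x :: real by linarith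
  ultimately show False unfolding e_def dist_real_def
    by (metis add_strict_mono field_sum_of_halves not_less)
qed

lemma smooth_on_funpow: "smooth_on F S \<Longrightarrow> smooth_on ((dir_deriv v ^^ n) F) S"
  by (induction n) (auto intro: smooth_on_dir_deriv)

lemma dir_deriv_funpow_cong:
  assumes "open S" "\<And>z. z \<in> S \<Longrightarrow> F z = G z"
  shows "z \<in> S \<Longrightarrow> (dir_deriv v ^^ n) F z = (dir_deriv v ^^ n) G z"
proof (induction n arbitrary: z)
  case (Suc n)
  show ?case using dir_deriv_cong[OF assms(1) Suc.prems Suc.IH] by simp
qed (use assms in simp)

lemma dir_deriv_funpow_commute:
  assumes "open S" "smooth_on F S"
  shows "z \<in> S \<Longrightarrow> (dir_deriv v ^^ n) (dir_deriv u F) z = dir_deriv u ((dir_deriv v ^^ n) F) z"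
proof (induction n arbitrary: z)
  case (Suc n)
  have "(dir_deriv v ^^ Suc n) (dir_deriv u F) z = dir_deriv v (dir_deriv u ((dir_deriv v ^^ n) F)) z"
    using dir_deriv_cong[OF assms(1) Suc.prems Suc.IH] by simp
  also have "\<dots> = dir_deriv u ((dir_deriv v ^^ Suc n) F) z"
    using dir_deriv_commute[OF assms(1) Suc.prems smooth_on_funpow[OF assms(2)]] by simp
  finally show ?case .
qed simp

section \<open>Homogeneous Taylor components\<close>

lemma taylor_coeff_dir_deriv_ii:
  "taylor_coeff (dir_deriv \<i> F) i j = real (Suc j) * taylor_coeff F i (Suc j)"
proof -
  have "partial_deriv i j (dir_deriv \<i> F) 0 = partial_deriv i (Suc j) F 0"
    unfolding partial_deriv_def by (simp add: funpow_Suc_right del: funpow.simps)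
  then show ?thesis by (simp add: taylor_coeff_def field_simps del: of_nat_Suc)
qed

text \<open>\<open>partial_deriv\<close> applies the derivatives in direction \<open>\<i>\<close>
  first, so the extra derivative in direction 1 has to be moved past them by symmetry.\<close>

lemma taylor_coeff_dir_deriv_1:
  assumes "open S" "0 \<in> S" "smooth_on F S"
  shows "taylor_coeff (dir_deriv 1 F) i j = real (Suc i) * taylor_coeff F (Suc i) j"
proof -
  have "partial_deriv i j (dir_deriv 1 F) 0 = (dir_deriv 1 ^^ i) (dir_deriv 1 ((dir_deriv \<i> ^^ j) F)) 0"
    unfolding partial_deriv_def
    by (rule dir_deriv_funpow_cong[OF assms(1) _ assms(2)]) (rule dir_deriv_funpow_commute[OF assms(1,3)])
  also have "\<dots> = partial_deriv (Suc i) j F 0"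
    unfolding partial_deriv_def by (simp add: funpow_Suc_right del: funpow.simps)
  finally show ?thesis by (simp add: taylor_coeff_def field_simps del: of_nat_Suc)
qed

text \<open>The polynomial compared in \<open>taylor_series_in_r2\<close>, as a function of the
  point instead of its two coordinates.\<close>

definition taylor_hom :: "(complex \<Rightarrow> real) \<Rightarrow> nat \<Rightarrow> complex \<Rightarrow> real" where
  "taylor_hom F n z = (\<Sum>i\<le>n. taylor_coeff F i (n - i) * Re z ^ i * Im z ^ (n - i))"

lemma taylor_hom_0: "taylor_hom F 0 z = F 0"
  by (simp add: taylor_hom_def taylor_coeff_def partial_deriv_def)

lemma taylor_hom_scale: "taylor_hom F n (of_real r * z) = r ^ n * taylor_hom F n z"
  unfolding taylor_hom_def sum_distrib_left
proof (rule sum.cong)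
  fix i assume "i \<in> {..n}"
  then have "r ^ n = r ^ i * r ^ (n - i)" by (simp flip: power_add)
  then show "taylor_coeff F i (n - i) * Re (of_real r * z) ^ i * Im (of_real r * z) ^ (n - i)
      = r ^ n * (taylor_coeff F i (n - i) * Re z ^ i * Im z ^ (n - i))"
    by (simp add: power_mult_distrib)
qed simp

text \<open>Differentiation acts on the Taylor coefficients by an index shift, lowering the degree
  by one. This makes gradients of Taylor remainders again Taylor remainders.\<close>

lemma has_derivative_taylor_hom:
  assumes "open S" "0 \<in> S" "smooth_on F S"
  shows "(taylor_hom F (Suc n) has_derivative
    (\<lambda>h. Re h * taylor_hom (dir_deriv 1 F) n z + Im h * taylor_hom (dir_deriv \<i> F) n z)) (at z)"
proof -
  let ?c = "taylor_coeff F"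
  let ?A = "\<lambda>i. ?c i (Suc n - i) * (real i * Re z ^ (i - 1) * Im z ^ (Suc n - i))"
  let ?B = "\<lambda>i. ?c i (Suc n - i) * (Re z ^ i * (real (Suc n - i) * Im z ^ (Suc n - i - 1)))"
  have "((\<lambda>z. \<Sum>i\<le>Suc n. ?c i (Suc n - i) * (Re z ^ i * Im z ^ (Suc n - i))) has_derivative
      (\<lambda>h. \<Sum>i\<le>Suc n. ?c i (Suc n - i) * (Re z ^ i * (of_nat (Suc n - i) * Im h * Im z ^ (Suc n - i - 1))
            + of_nat i * Re h * Re z ^ (i - 1) * Im z ^ (Suc n - i)))) (at z)"
    by (intro has_derivative_sum has_derivative_mult_right has_derivative_mult has_derivative_power
        bounded_linear_imp_has_derivative bounded_linear_Re bounded_linear_Im)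
  moreover have "(\<Sum>i\<le>Suc n. ?c i (Suc n - i) * (Re z ^ i * (of_nat (Suc n - i) * Im h * Im z ^ (Suc n - i - 1))
            + of_nat i * Re h * Re z ^ (i - 1) * Im z ^ (Suc n - i)))
      = Re h * taylor_hom (dir_deriv 1 F) n z + Im h * taylor_hom (dir_deriv \<i> F) n z" for h
  proof -
    \<comment> \<open>The term \<open>i = 0\<close> has the factor \<open>real 0\<close>, so the
      index can be shifted; in \<open>?B\<close> it is the last term that vanishes, as
      \<open>Suc n - i\<close> is 0 there.\<close>
    have "(\<Sum>i\<le>Suc n. ?A i) = (\<Sum>i\<le>n. ?A (Suc i))"
      by (subst sum.atMost_Suc_shift) simp
    also have "\<dots> = taylor_hom (dir_deriv 1 F) n z"
      by (simp add: taylor_hom_def taylor_coeff_dir_deriv_1[OF assms] mult_ac)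
    finally have A: "(\<Sum>i\<le>Suc n. ?A i) = taylor_hom (dir_deriv 1 F) n z" .
    have "(\<Sum>i\<le>Suc n. ?B i) = (\<Sum>i\<le>n. ?B i)" by simp
    also have "\<dots> = taylor_hom (dir_deriv \<i> F) n z"
      unfolding taylor_hom_def
      by (rule sum.cong) (auto simp: taylor_coeff_dir_deriv_ii Suc_diff_le mult_ac)
    finally have B: "(\<Sum>i\<le>Suc n. ?B i) = taylor_hom (dir_deriv \<i> F) n z" .
    have "?c i (Suc n - i) * (Re z ^ i * (of_nat (Suc n - i) * Im h * Im z ^ (Suc n - i - 1))
            + of_nat i * Re h * Re z ^ (i - 1) * Im z ^ (Suc n - i)) = Re h * ?A i + Im h * ?B i" for i
      by (simp only: algebra_simps)
    then show ?thesis
      unfolding A[symmetric] B[symmetric] sum_distrib_left sum.distrib[symmetric] by (rule sum.cong[OF refl])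
  qed
  ultimately show ?thesis
    unfolding taylor_hom_def[of F "Suc n", abs_def] mult.assoc[of "taylor_coeff _ _ _"] by simp
qed

section \<open>Taylor remainders and their order at the origin\<close>

definition taylor_remainder :: "(complex \<Rightarrow> real) \<Rightarrow> nat \<Rightarrow> complex \<Rightarrow> real" where
  "taylor_remainder F n z = F z - (\<Sum>m\<le>n. taylor_hom F m z)"

lemma taylor_remainder_at_0: "taylor_remainder F n 0 = 0"
proof -
  have "taylor_hom F m 0 = (if m = 0 then F 0 else 0)" for m
    using taylor_hom_scale[of F m 0 0] by (auto simp: taylor_hom_0 power_0_left)
  then show ?thesis by (simp add: taylor_remainder_def)
qed

lemma has_derivative_taylor_remainder_0:
  assumes "open S" "z \<in> S" "smooth_on F S"
  shows "(taylor_remainder F 0 has_derivative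
      (\<lambda>h. Re h * dir_deriv 1 F z + Im h * dir_deriv \<i> F z)) (at z)"
proof -
  have "taylor_remainder F 0 = (\<lambda>z. F z - F 0)"
    by (simp add: taylor_remainder_def taylor_hom_0 fun_eq_iff)
  then show ?thesis
    using has_derivative_diff[OF has_derivative_dir_deriv[OF smooth_on_differentiable[OF assms(3,2)]]
        has_derivative_const[of "F 0"]] by simp
qed

lemma has_derivative_taylor_remainder_Suc:
  assumes "open S" "0 \<in> S" "z \<in> S" "smooth_on F S"
  shows "(taylor_remainder F (Suc n) has_derivative
      (\<lambda>h. Re h * taylor_remainder (dir_deriv 1 F) n z + Im h * taylor_remainder (dir_deriv \<i> F) n z)) (at z)"
proof -
  have eq: "taylor_remainder F (Suc n) = (\<lambda>z. F z - (F 0 + (\<Sum>m\<le>n. taylor_hom F (Suc m) z)))"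
    by (simp add: taylor_remainder_def fun_eq_iff taylor_hom_0 sum.atMost_Suc_shift del: sum.atMost_Suc)
  have "((\<lambda>z. F z - (F 0 + (\<Sum>m\<le>n. taylor_hom F (Suc m) z))) has_derivative
    (\<lambda>h. (Re h * dir_deriv 1 F z + Im h * dir_deriv \<i> F z) - (0 + (\<Sum>m\<le>n.
       Re h * taylor_hom (dir_deriv 1 F) m z + Im h * taylor_hom (dir_deriv \<i> F) m z)))) (at z)"
    by (intro has_derivative_diff has_derivative_add has_derivative_const has_derivative_sum
        has_derivative_dir_deriv smooth_on_differentiable[OF assms(4,3)]
        has_derivative_taylor_hom[OF assms(1,2,4)])
  then show ?thesis
    unfolding eq taylor_remainder_def
    by (simp add: algebra_simps sum.distrib sum_distrib_left)
qed

text \<open>Mean value theorem on the segment from 0 to \<open>z\<close>, which gains one power of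
  \<open>cmod z\<close>. The factor 2 comes from bounding the two coordinates of \<open>z\<close>
  separately.\<close>

lemma bound_from_gradient:
  assumes "r > 0" "G (0 :: complex) = (0 :: real)"
    and D: "\<And>z. cmod z < r \<Longrightarrow> (G has_derivative (\<lambda>h. Re h * A z + Im h * B z)) (at z)"
    and A: "\<And>z. cmod z < r \<Longrightarrow> \<bar>A z\<bar> \<le> C * cmod z ^ m"
    and B: "\<And>z. cmod z < r \<Longrightarrow> \<bar>B z\<bar> \<le> C * cmod z ^ m"
    and z: "cmod z < r" and C: "C \<ge> 0"
  shows "\<bar>G z\<bar> \<le> 2 * C * cmod z ^ Suc m"
proof -
  have tz: "cmod (of_real t * z) \<le> cmod z" if "0 \<le> t" "t \<le> 1" for t
    using mult_left_le_one_le[OF norm_ge_zero that, of z] that by (simp only: norm_mult norm_of_real abs_of_nonneg)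
  have tz': "cmod (of_real t * z) < r" if "0 \<le> t" "t \<le> 1" for t
    using tz[OF that] z by linarith
  have "((\<lambda>t. G (0 + of_real t * z)) has_real_derivative dir_deriv z G (0 + of_real t * z)) (at t)"
    if "0 \<le> t" "t \<le> 1" for t
  proof (rule has_real_derivative_line)
    show "G differentiable (at (0 + of_real t * z))"
      unfolding add_0 differentiable_def using D[OF tz'[OF that]] by blast
  qed
  then obtain t where t: "0 < t" "t < 1"
    and "G (0 + of_real 1 * z) - G (0 + of_real 0 * z) = (1 - 0) * dir_deriv z G (0 + of_real t * z)"
    using MVT2[of 0 1 "\<lambda>t. G (0 + of_real t * z)" "\<lambda>t. dir_deriv z G (0 + of_real t * z)"] by auto
  then have "G z = dir_deriv z G (of_real t * z)"
    using assms(2) by simp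
  also have "\<dots> = Re z * A (of_real t * z) + Im z * B (of_real t * z)"
    by (rule dir_deriv_eq[OF D]) (use tz' t in simp)
  finally have Gz: "G z = Re z * A (of_real t * z) + Im z * B (of_real t * z)" .
  have le: "C * cmod (of_real t * z) ^ m \<le> C * cmod z ^ m"
    using tz[of t] t C by (intro mult_left_mono power_mono) simp_all
  have r: "cmod (of_real t * z) < r" using tz' t by simp
  have "\<bar>Re z * A (of_real t * z)\<bar> \<le> cmod z * (C * cmod z ^ m)"
    unfolding abs_mult by (rule mult_mono[OF abs_Re_le_cmod order_trans[OF A[OF r] le]]) simp_all
  moreover have "\<bar>Im z * B (of_real t * z)\<bar> \<le> cmod z * (C * cmod z ^ m)"
    unfolding abs_mult by (rule mult_mono[OF abs_Im_le_cmod order_trans[OF B[OF r] le]]) simp_all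
  ultimately show ?thesis unfolding Gz by (simp add: mult_ac)
qed

text \<open>Induction for all \<open>F\<close> at once: the gradient of the remainder of order
  \<open>Suc n\<close> consists of the order \<open>n\<close> remainders of the partial derivatives.
  For \<open>n = 0\<close> continuity bounds the gradient.\<close>

lemma taylor_remainder_bound:
  assumes "open S" "0 \<in> S" "smooth_on F S"
  shows "\<exists>C r. 0 \<le> C \<and> 0 < r \<and> (\<forall>z. cmod z < r \<longrightarrow> \<bar>taylor_remainder F n z\<bar> \<le> C * cmod z ^ Suc n)"
  using assms(3)
proof (induction n arbitrary: F)
  case 0
  obtain r where r: "r > 0" "ball 0 r \<subseteq> S" using assms openE by blast
  have "isCont (dir_deriv 1 F) 0" "isCont (dir_deriv \<i> F) 0"
    using smooth_on_continuous_on[OF smooth_on_dir_deriv[OF 0]] assms(1,2)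
    by (simp_all add: continuous_on_eq_continuous_at)
  moreover have "\<forall>\<^sub>F z in nhds 0. dist (g z) (g 0) < 1" if "isCont g 0" for g :: "complex \<Rightarrow> real"
    using tendstoD[of g "g 0" "nhds 0" 1] that by (simp add: isCont_def tendsto_at_iff_tendsto_nhds)
  ultimately have "\<forall>\<^sub>F z in nhds 0. dist (dir_deriv 1 F z) (dir_deriv 1 F 0) < 1"
     "\<forall>\<^sub>F z in nhds 0. dist (dir_deriv \<i> F z) (dir_deriv \<i> F 0) < 1"
    by blast+
  moreover have "\<forall>\<^sub>F z in nhds 0. cmod z < r"
    using r(1) by (auto simp: eventually_nhds_metric)
  ultimately have "\<forall>\<^sub>F z in nhds 0. cmod z < r \<and> dist (dir_deriv 1 F z) (dir_deriv 1 F 0) < 1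
      \<and> dist (dir_deriv \<i> F z) (dir_deriv \<i> F 0) < 1"
    by eventually_elim auto
  then obtain r' where r': "r' > 0" and near: "\<And>z. cmod z < r' \<Longrightarrow> cmod z < r \<and>
      dist (dir_deriv 1 F z) (dir_deriv 1 F 0) < 1 \<and> dist (dir_deriv \<i> F z) (dir_deriv \<i> F 0) < 1"
    unfolding eventually_nhds_metric by auto
  \<comment> \<open>Within \<open>r'\<close> each partial derivative differs from its value at 0 by
    less than 1.\<close>
  define C where "C = 1 + \<bar>dir_deriv 1 F 0\<bar> + \<bar>dir_deriv \<i> F 0\<bar>"
  have "\<bar>taylor_remainder F 0 z\<bar> \<le> 2 * C * cmod z ^ Suc 0" if "cmod z < r'" for z
  proof (rule bound_from_gradient[where A = "dir_deriv 1 F" and B = "dir_deriv \<i> F"])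
    show "(taylor_remainder F 0 has_derivative
      (\<lambda>h. Re h * dir_deriv 1 F z + Im h * dir_deriv \<i> F z)) (at z)" if "cmod z < r'" for z
      using near[OF that] r(2)
      by (intro has_derivative_taylor_remainder_0[OF assms(1) _ 0]) (auto simp: subset_eq)
    show "\<bar>dir_deriv 1 F z\<bar> \<le> C * cmod z ^ 0" "\<bar>dir_deriv \<i> F z\<bar> \<le> C * cmod z ^ 0" if "cmod z < r'" for z
      using near[OF that] by (auto simp: C_def dist_real_def)
  qed (use r' that in \<open>simp_all add: C_def taylor_remainder_at_0\<close>)
  moreover have "0 \<le> 2 * C" by (simp add: C_def)
  ultimately show ?case using r' by blast
next
  case (Suc n)
  obtain r where r: "r > 0" "ball 0 r \<subseteq> S" using assms openE by blast
  obtain C1 r1 where 1: "0 \<le> C1" "0 < r1"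
    "\<And>z. cmod z < r1 \<Longrightarrow> \<bar>taylor_remainder (dir_deriv 1 F) n z\<bar> \<le> C1 * cmod z ^ Suc n"
    using Suc.IH[OF smooth_on_dir_deriv[OF Suc.prems]] by meson
  obtain C2 r2 where 2: "0 \<le> C2" "0 < r2"
    "\<And>z. cmod z < r2 \<Longrightarrow> \<bar>taylor_remainder (dir_deriv \<i> F) n z\<bar> \<le> C2 * cmod z ^ Suc n"
    using Suc.IH[OF smooth_on_dir_deriv[OF Suc.prems]] by meson
  have "\<bar>taylor_remainder F (Suc n) z\<bar> \<le> 2 * (C1 + C2) * cmod z ^ Suc (Suc n)"
    if "cmod z < min r (min r1 r2)" for z
  proof (rule bound_from_gradient[where A = "taylor_remainder (dir_deriv 1 F) n"
        and B = "taylor_remainder (dir_deriv \<i> F) n"])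
    fix z assume z: "cmod z < min r (min r1 r2)"
    show "(taylor_remainder F (Suc n) has_derivative
      (\<lambda>h. Re h * taylor_remainder (dir_deriv 1 F) n z + Im h * taylor_remainder (dir_deriv \<i> F) n z)) (at z)"
      using z r(2) by (intro has_derivative_taylor_remainder_Suc[OF assms(1,2) _ Suc.prems]) (auto simp: subset_eq)
    show "\<bar>taylor_remainder (dir_deriv 1 F) n z\<bar> \<le> (C1 + C2) * cmod z ^ Suc n"
      by (rule order_trans[OF 1(3)]) (use z 2(1) in \<open>auto intro!: mult_right_mono\<close>)
    show "\<bar>taylor_remainder (dir_deriv \<i> F) n z\<bar> \<le> (C1 + C2) * cmod z ^ Suc n"
      by (rule order_trans[OF 2(3)]) (use z 1(1) in \<open>auto intro!: mult_right_mono\<close>)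
  qed (use r 1 2 that in \<open>simp_all add: taylor_remainder_at_0\<close>)
  moreover have "0 \<le> 2 * (C1 + C2)" "0 < min r (min r1 r2)" using r 1 2 by auto
  ultimately show ?case by blast
qed

section \<open>Real-analytic functions\<close>

text \<open>The right side dominates the linear term in the binomial expansion of
  \<open>(s + (t - s)) ^ n\<close>. For \<open>s < t\<close> it shows that differentiating a power
  costs only a slightly larger radius and the factor \<open>1 / (t - s)\<close>.\<close>

lemma power_ge_tangent:
  fixes s t :: real
  assumes "0 \<le> s" "s \<le> t"
  shows "real n * s ^ (n - 1) * (t - s) \<le> t ^ n"
proof (induction n)
  case (Suc n)
  have "s ^ n \<le> t ^ n" using assms by (intro power_mono)
  have "real (Suc n) * s ^ n * (t - s) = s ^ n * (t - s) + s * (real n * s ^ (n - 1) * (t - s))"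
    by (cases n) (auto simp: algebra_simps)
  also have "\<dots> \<le> t ^ n * (t - s) + s * t ^ n"
    using Suc assms \<open>s ^ n \<le> t ^ n\<close> by (intro add_mono mult_right_mono mult_left_mono) auto
  also have "\<dots> = t ^ Suc n" by (simp add: algebra_simps)
  finally show ?case by simp
qed simp

section \<open>Double power series on squares and their termwise derivatives\<close>

lemma open_square: "open {z. \<bar>Re z\<bar> < r \<and> \<bar>Im z\<bar> < r}"
  by (intro open_Collect_conj open_Collect_less continuous_intros)

lemma convex_square: "convex {z. \<bar>Re z\<bar> < r \<and> \<bar>Im z\<bar> < r}"
proof -
  have "{z. \<bar>Re z\<bar> < r \<and> \<bar>Im z\<bar> < r} =
      {z. Re z < r} \<inter> {z. Re z > - r} \<inter> {z. Im z < r} \<inter> {z. Im z > - r}"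
    by auto
  then show ?thesis
    by (simp add: convex_Int convex_halfspace_Re_lt convex_halfspace_Re_gt
        convex_halfspace_Im_lt convex_halfspace_Im_gt)
qed

text \<open>Turns an unordered double sum into an ordinary series, to which the M-test and termwise
  differentiation apply.\<close>

lemma has_sum_prod_decode:
  assumes "(f has_sum l) UNIV"
  shows "(\<lambda>n. f (prod_decode n)) sums l"
proof -
  have "((\<lambda>n. f (prod_decode n)) has_sum l) UNIV"
    by (rule has_sum_reindex_bij_betw[OF bij_prod_decode, THEN iffD2]) (fact assms)
  then show ?thesis by (rule has_sum_imp_sums)
qed

text \<open>For \<open>s < t < r\<close> the series converges absolutely at the corner
  \<open>(t, t)\<close>, and its terms, up to the factor \<open>1 / (t - s)\<close>, dominate the
  differentiated terms on the square \<open>S s\<close>. The derivative series thus converge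
  uniformly there, and termwise differentiation is justified.\<close>

lemma power_series2_derivative:
  fixes a :: "nat \<Rightarrow> nat \<Rightarrow> real"
  defines "S \<equiv> \<lambda>r. {z. \<bar>Re z\<bar> < r \<and> \<bar>Im z\<bar> < r}"
  assumes F: "\<And>z. z \<in> S r \<Longrightarrow> ((\<lambda>(i, j). Re z ^ i * Im z ^ j * a i j) has_sum F z) UNIV"
  obtains G H where
    "\<And>z. z \<in> S r \<Longrightarrow> (F has_derivative (\<lambda>h. Re h * G z + Im h * H z)) (at z)"
    "\<And>z. z \<in> S r \<Longrightarrow>
       ((\<lambda>(i, j). Re z ^ i * Im z ^ j * (real (Suc i) * a (Suc i) j)) has_sum G z) UNIV"
    "\<And>z. z \<in> S r \<Longrightarrow>
       ((\<lambda>(i, j). Re z ^ i * Im z ^ j * (real (Suc j) * a i (Suc j))) has_sum H z) UNIV"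
proof -
  \<comment> \<open>Formal partial derivatives of the terms; the truncated exponent
    \<open>i - 1\<close> at \<open>i = 0\<close> is harmless because of the factor
    \<open>real i\<close>.\<close>
  define X where "X = (\<lambda>z (i, j). real i * Re z ^ (i - 1) * Im z ^ j * a i j)"
  define Y where "Y = (\<lambda>z (i, j). real j * Re z ^ i * Im z ^ (j - 1) * a i j)"
  define G where "G z = infsum (X z) UNIV" for z
  define H where "H z = infsum (Y z) UNIV" for z
  have bound: "\<exists>M. M summable_on UNIV \<and>
      (\<forall>z\<in>S s. \<forall>ij. \<bar>X z ij\<bar> \<le> M ij \<and> \<bar>Y z ij\<bar> \<le> M ij)" if s: "0 < s" "s < r" for s
  proof -
    define t where "t = (s + r) / 2"
    have t: "s < t" "t < r" "0 < t" using s by (auto simp: t_def)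
    define M where "M = (\<lambda>(i, j). t ^ i * t ^ j * \<bar>a i j\<bar> / (t - s))"
    have "((\<lambda>(i, j). t ^ i * t ^ j * a i j) has_sum F (Complex t t)) UNIV"
      using F[of "Complex t t"] t by (simp add: S_def)
    then have "(\<lambda>(i, j). t ^ i * t ^ j * a i j) summable_on UNIV"
      by (auto simp: summable_on_def)
    then have "(\<lambda>ij. \<bar>(\<lambda>(i, j). t ^ i * t ^ j * a i j) ij\<bar>) summable_on UNIV"
      using summable_on_iff_abs_summable_on_real by (metis (no_types, lifting) real_norm_def summable_on_cong)
    then have "(\<lambda>ij. (\<lambda>(i, j). t ^ i * t ^ j * \<bar>a i j\<bar>) ij * (1 / (t - s))) summable_on UNIV"
      using t by (intro summable_on_cmult_left) (simp add: case_prod_unfold abs_mult)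
    then have M: "M summable_on UNIV"
      by (simp add: M_def case_prod_unfold)
    have pw: "real i * x ^ (i - 1) \<le> t ^ i / (t - s)" if "0 \<le> x" "x < s" for x i
    proof -
      have "x ^ (i - 1) \<le> s ^ (i - 1)" using that by (intro power_mono) auto
      then have "real i * x ^ (i - 1) \<le> real i * s ^ (i - 1)" by (intro mult_left_mono) auto
      also have "\<dots> \<le> t ^ i / (t - s)"
        using power_ge_tangent[of s t i] s t by (simp add: pos_le_divide_eq)
      finally show ?thesis .
    qed
    have pw': "x ^ i \<le> t ^ i" if "0 \<le> x" "x < s" for x i
      using that t by (intro power_mono) auto
    have "\<bar>X z (i, j)\<bar> \<le> M (i, j) \<and> \<bar>Y z (i, j)\<bar> \<le> M (i, j)" if "z \<in> S s" for z i j
    proof -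
      have z: "\<bar>Re z\<bar> < s" "\<bar>Im z\<bar> < s" using that by (auto simp: S_def)
      note pws = pw[OF abs_ge_zero z(1), of i] pw[OF abs_ge_zero z(2), of j]
        pw'[OF abs_ge_zero z(1), of i] pw'[OF abs_ge_zero z(2), of j]
      have "(real i * \<bar>Re z\<bar> ^ (i - 1)) * \<bar>Im z\<bar> ^ j * \<bar>a i j\<bar> \<le> t ^ i / (t - s) * t ^ j * \<bar>a i j\<bar>"
        by (intro mult_right_mono mult_mono pws) (use t in simp_all)
      moreover have "\<bar>Re z\<bar> ^ i * (real j * \<bar>Im z\<bar> ^ (j - 1)) * \<bar>a i j\<bar> \<le> t ^ i * (t ^ j / (t - s)) * \<bar>a i j\<bar>"
        by (intro mult_right_mono mult_mono pws) (use t in simp_all)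
      ultimately show ?thesis by (simp add: X_def Y_def M_def abs_mult power_abs mult_ac)
    qed
    then show ?thesis using M by auto
  qed
  have inside: "\<exists>s. 0 < s \<and> s < r \<and> z \<in> S s" if "z \<in> S r" for z
    using that by (intro exI[of _ "(max \<bar>Re z\<bar> \<bar>Im z\<bar> + r) / 2"]) (auto simp: S_def)
  have XG: "(X z has_sum G z) UNIV" and YH: "(Y z has_sum H z) UNIV" if z: "z \<in> S r" for z
  proof -
    obtain M where M: "M summable_on UNIV" "\<forall>ij. \<bar>X z ij\<bar> \<le> M ij \<and> \<bar>Y z ij\<bar> \<le> M ij"
      using inside[OF z] bound by meson
    have "(\<lambda>ij. norm (X z ij)) summable_on UNIV"
      by (rule Infinite_Sum.abs_summable_on_comparison_test'[OF M(1)]) (unfold real_norm_def, use M(2) in blast)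
    moreover have "(\<lambda>ij. norm (Y z ij)) summable_on UNIV"
      by (rule Infinite_Sum.abs_summable_on_comparison_test'[OF M(1)]) (unfold real_norm_def, use M(2) in blast)
    ultimately show "(X z has_sum G z) UNIV" "(Y z has_sum H z) UNIV"
      unfolding G_def H_def by (blast intro: has_sum_infsum abs_summable_summable)+
  qed
  show ?thesis
  proof (rule that)
    fix z assume z: "z \<in> S r"
    obtain s where s: "0 < s" "s < r" and zs: "z \<in> S s" using inside[OF z] by blast
    have sub: "S s \<subseteq> S r" using s by (auto simp: S_def)
    obtain M where M: "M summable_on UNIV"
      and XM: "\<And>z ij. z \<in> S s \<Longrightarrow> \<bar>X z ij\<bar> \<le> M ij" and YM: "\<And>z ij. z \<in> S s \<Longrightarrow> \<bar>Y z ij\<bar> \<le> M ij"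
      using bound[OF s] by blast
    have "summable (\<lambda>n. M (prod_decode n))"
      by (rule sums_summable[OF has_sum_prod_decode[OF has_sum_infsum[OF M]]])
    note M_test = Weierstrass_m_test[OF _ this, of "S s"]
    have uX: "uniform_limit (S s) (\<lambda>n w. \<Sum>i<n. X w (prod_decode i)) G sequentially"
    proof (rule uniform_limit_cong'[THEN iffD1])
      show "uniform_limit (S s) (\<lambda>n w. \<Sum>i<n. X w (prod_decode i)) (\<lambda>w. \<Sum>i. X w (prod_decode i)) sequentially"
        by (rule M_test) (unfold real_norm_def, rule XM)
      show "(\<Sum>i. X w (prod_decode i)) = G w" if "w \<in> S s" for w
        by (rule sums_unique[symmetric, OF has_sum_prod_decode[OF XG]]) (use that sub in blast)
    qed simp
    have uY: "uniform_limit (S s) (\<lambda>n w. \<Sum>i<n. Y w (prod_decode i)) H sequentially"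
    proof (rule uniform_limit_cong'[THEN iffD1])
      show "uniform_limit (S s) (\<lambda>n w. \<Sum>i<n. Y w (prod_decode i)) (\<lambda>w. \<Sum>i. Y w (prod_decode i)) sequentially"
        by (rule M_test) (unfold real_norm_def, rule YM)
      show "(\<Sum>i. Y w (prod_decode i)) = H w" if "w \<in> S s" for w
        by (rule sums_unique[symmetric, OF has_sum_prod_decode[OF YH]]) (use that sub in blast)
    qed simp
    define f where "f n w = (\<lambda>(i, j). Re w ^ i * Im w ^ j * a i j) (prod_decode n)" for n w
    define f' where "f' n w h = Re h * X w (prod_decode n) + Im h * Y w (prod_decode n)" for n w h
    have "\<exists>g. \<forall>w\<in>S s. (\<lambda>n. f n w) sums g w \<and>
        (g has_derivative (\<lambda>h. Re h * G w + Im h * H w)) (at w within S s)"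
    proof (rule has_derivative_series[where f' = f'])
      show "convex (S s)" unfolding S_def by (rule convex_square)
      show "(f n has_derivative f' n w) (at w within S s)" for n w
      proof -
        obtain i j where ij: "prod_decode n = (i, j)" by fastforce
        have "((\<lambda>w. Re w ^ i * Im w ^ j * a i j) has_derivative
            (\<lambda>h. (Re w ^ i * (of_nat j * Im h * Im w ^ (j - 1)) +
                  of_nat i * Re h * Re w ^ (i - 1) * Im w ^ j) * a i j)) (at w within S s)"
          by (intro has_derivative_mult_left has_derivative_mult has_derivative_power
              bounded_linear_imp_has_derivative bounded_linear_Re bounded_linear_Im)
        moreover have "f n = (\<lambda>w. Re w ^ i * Im w ^ j * a i j)"
          by (simp add: f_def fun_eq_iff ij)
        moreover have "f' n w = (\<lambda>h. (Re w ^ i * (of_nat j * Im h * Im w ^ (j - 1)) +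
                  of_nat i * Re h * Re w ^ (i - 1) * Im w ^ j) * a i j)"
          by (simp add: f'_def X_def Y_def fun_eq_iff ij algebra_simps)
        ultimately show ?thesis by simp
      qed
      show "z \<in> S s" by (fact zs)
      show "(\<lambda>n. f n z) sums F z"
        unfolding f_def by (rule has_sum_prod_decode[OF F[OF z]])
      fix e :: real assume e: "e > 0"
      have "\<forall>\<^sub>F n in sequentially. \<forall>w\<in>S s. \<bar>(\<Sum>i<n. X w (prod_decode i)) - G w\<bar> < e / 2"
        using uniform_limitD[OF uX, of "e / 2"] e by (simp add: dist_real_def)
      moreover have "\<forall>\<^sub>F n in sequentially. \<forall>w\<in>S s. \<bar>(\<Sum>i<n. Y w (prod_decode i)) - H w\<bar> < e / 2"
        using uniform_limitD[OF uY, of "e / 2"] e by (simp add: dist_real_def)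
      ultimately show "\<forall>\<^sub>F n in sequentially. \<forall>w\<in>S s. \<forall>h.
          norm ((\<Sum>i<n. f' i w h) - (Re h * G w + Im h * H w)) \<le> e * norm h"
      proof eventually_elim
        case (elim n)
        show ?case
        proof (intro ballI allI)
          fix w h assume w: "w \<in> S s"
          have "(\<Sum>i<n. f' i w h) - (Re h * G w + Im h * H w) =
              Re h * ((\<Sum>i<n. X w (prod_decode i)) - G w) + Im h * ((\<Sum>i<n. Y w (prod_decode i)) - H w)"
            by (simp add: f'_def sum.distrib sum_distrib_left algebra_simps)
          also have "norm \<dots> \<le> norm h * (e / 2) + norm h * (e / 2)"
          proof (rule norm_triangle_le[OF add_mono])
            show "norm (Re h * ((\<Sum>i<n. X w (prod_decode i)) - G w)) \<le> norm h * (e / 2)"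
              unfolding real_norm_def abs_mult
              by (rule mult_mono[OF abs_Re_le_cmod]) (use elim(1) w in \<open>force intro: less_imp_le\<close>)+
            show "norm (Im h * ((\<Sum>i<n. Y w (prod_decode i)) - H w)) \<le> norm h * (e / 2)"
              unfolding real_norm_def abs_mult
              by (rule mult_mono[OF abs_Im_le_cmod]) (use elim(2) w in \<open>force intro: less_imp_le\<close>)+
          qed
          finally show "norm ((\<Sum>i<n. f' i w h) - (Re h * G w + Im h * H w)) \<le> e * norm h"
            by (simp add: mult.commute)
        qed
      qed
    qed
    then obtain g where g: "\<And>w. w \<in> S s \<Longrightarrow> (\<lambda>n. f n w) sums g w"
        "(g has_derivative (\<lambda>h. Re h * G z + Im h * H z)) (at z within S s)"
      using zs by blast
    have op: "open (S s)" unfolding S_def by (rule open_square)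
    have "g w = F w" if "w \<in> S s" for w
      using g(1)[OF that] has_sum_prod_decode[OF F] sub that unfolding f_def
      by (metis (no_types, lifting) subsetD sums_unique2)
    then show "(F has_derivative (\<lambda>h. Re h * G z + Im h * H z)) (at z)"
      using g(2) at_within_open[OF zs op] has_derivative_transform_within_open[OF _ op zs, of g _ UNIV F]
      by simp
  next
    fix z assume z: "z \<in> S r"
    \<comment> \<open>Only indices with \<open>i \<noteq> 0\<close> contribute; shifting them down
      by one restores power series form.\<close>
    have bij: "bij_betw (map_prod Suc id) UNIV {(i, j :: nat). i \<noteq> 0}"
      by (rule bij_betwI[where g = "map_prod (\<lambda>i. i - 1) id"]) auto
    have "(X z has_sum G z) {(i, j). i \<noteq> 0}"
      by (rule has_sum_cong_neutral[THEN iffD1, OF _ _ _ XG[OF z]]) (auto simp: X_def)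
    then have "((\<lambda>ij. X z (map_prod Suc id ij)) has_sum G z) UNIV"
      by (rule has_sum_reindex_bij_betw[OF bij, THEN iffD2])
    then show "((\<lambda>(i, j). Re z ^ i * Im z ^ j * (real (Suc i) * a (Suc i) j)) has_sum G z) UNIV"
      by (simp add: X_def case_prod_unfold mult_ac)
  next
    fix z assume z: "z \<in> S r"
    have bij: "bij_betw (map_prod id Suc) UNIV {(i :: nat, j). j \<noteq> 0}"
      by (rule bij_betwI[where g = "map_prod id (\<lambda>i. i - 1)"]) auto
    have "(Y z has_sum H z) {(i, j). j \<noteq> 0}"
      by (rule has_sum_cong_neutral[THEN iffD1, OF _ _ _ YH[OF z]]) (auto simp: Y_def)
    then have "((\<lambda>ij. Y z (map_prod id Suc ij)) has_sum H z) UNIV"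
      by (rule has_sum_reindex_bij_betw[OF bij, THEN iffD2])
    then show "((\<lambda>(i, j). Re z ^ i * Im z ^ j * (real (Suc j) * a i (Suc j))) has_sum H z) UNIV"
      by (simp add: Y_def case_prod_unfold mult_ac)
  qed
qed

text \<open>Both partial derivatives are power series on the same square, so induction on the order
  runs with varying coefficients.\<close>

lemma power_series2_smooth_on:
  fixes a :: "nat \<Rightarrow> nat \<Rightarrow> real"
  assumes "\<And>z. z \<in> {z. \<bar>Re z\<bar> < r \<and> \<bar>Im z\<bar> < r} \<Longrightarrow>
      ((\<lambda>(i, j). Re z ^ i * Im z ^ j * a i j) has_sum F z) UNIV"
  shows "smooth_on F {z. \<bar>Re z\<bar> < r \<and> \<bar>Im z\<bar> < r}"
proof -
  have "Ck_on k F {z. \<bar>Re z\<bar> < r \<and> \<bar>Im z\<bar> < r}" for k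
    using assms
  proof (induction k arbitrary: a F)
    case 0
    obtain G H where d: "\<And>z. z \<in> {z. \<bar>Re z\<bar> < r \<and> \<bar>Im z\<bar> < r} \<Longrightarrow>
        (F has_derivative (\<lambda>h. Re h * G z + Im h * H z)) (at z)"
      by (rule power_series2_derivative[where r = r, OF 0]) (use that in blast)+
    show ?case unfolding Ck_on.simps
      by (rule continuous_at_imp_continuous_on) (use d has_derivative_continuous in blast)
  next
    case (Suc k)
    obtain G H where
      d: "\<And>z. z \<in> {z. \<bar>Re z\<bar> < r \<and> \<bar>Im z\<bar> < r} \<Longrightarrow>
        (F has_derivative (\<lambda>h. Re h * G z + Im h * H z)) (at z)"
      and G: "\<And>z. z \<in> {z. \<bar>Re z\<bar> < r \<and> \<bar>Im z\<bar> < r} \<Longrightarrow>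
       ((\<lambda>(i, j). Re z ^ i * Im z ^ j * (real (Suc i) * a (Suc i) j)) has_sum G z) UNIV"
      and H: "\<And>z. z \<in> {z. \<bar>Re z\<bar> < r \<and> \<bar>Im z\<bar> < r} \<Longrightarrow>
       ((\<lambda>(i, j). Re z ^ i * Im z ^ j * (real (Suc j) * a i (Suc j))) has_sum H z) UNIV"
      by (rule power_series2_derivative[where r = r, OF Suc.prems]) (use that in blast)+
    show ?case
    proof (rule Ck_on_SucI[OF open_square d])
      have "Ck_on k G {z. \<bar>Re z\<bar> < r \<and> \<bar>Im z\<bar> < r}" "Ck_on k H {z. \<bar>Re z\<bar> < r \<and> \<bar>Im z\<bar> < r}"
        by (rule Suc.IH, rule G, assumption) (rule Suc.IH, rule H, assumption)
      then show "Ck_on k (\<lambda>z. Re v * G z + Im v * H z) {z. \<bar>Re z\<bar> < r \<and> \<bar>Im z\<bar> < r}" for v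
        by (intro Ck_on_add[OF open_square] Ck_on_mult[OF open_square] Ck_on_const[OF open_square])
    qed
  qed
  then show ?thesis by (simp add: smooth_on_def)
qed

lemma real_analytic_at_0_smooth:
  assumes "real_analytic_at V (0 :: complex)"
  obtains r where "r > 0"
    "smooth_on (\<lambda>z. Re (V z)) {z. \<bar>Re z\<bar> < r \<and> \<bar>Im z\<bar> < r}"
    "smooth_on (\<lambda>z. Im (V z)) {z. \<bar>Re z\<bar> < r \<and> \<bar>Im z\<bar> < r}"
proof -
  obtain a r where r: "r > 0"
    and V: "\<And>x y. \<bar>x\<bar> < r \<and> \<bar>y\<bar> < r \<Longrightarrow>
        ((\<lambda>(i, j). (x ^ i * y ^ j) *\<^sub>R a i j) has_sum V (Complex x y)) UNIV"
    using assms unfolding real_analytic_at_def real_analytic2_at_def by auto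
  show ?thesis
  proof (rule that[OF r]; rule power_series2_smooth_on)
    fix z assume "z \<in> {z. \<bar>Re z\<bar> < r \<and> \<bar>Im z\<bar> < r}"
    then have z: "((\<lambda>(i, j). (Re z ^ i * Im z ^ j) *\<^sub>R a i j) has_sum V z) UNIV"
      using V[of "Re z" "Im z"] by simp
    show "((\<lambda>(i, j). Re z ^ i * Im z ^ j * Re (a i j)) has_sum Re (V z)) UNIV"
      using has_sum_Re[OF z] by (simp add: case_prod_unfold)
    show "((\<lambda>(i, j). Re z ^ i * Im z ^ j * Im (a i j)) has_sum Im (V z)) UNIV"
      using has_sum_Im[OF z] by (simp add: case_prod_unfold)
  qed
qed

text \<open>By homogeneity a component constant on the unit circle is a multiple of
  \<open>cmod z ^ N\<close>, and for odd \<open>N\<close> antipodal points force the multiple to be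
  0. If this happened in every degree, the Taylor series would be one in r^2.\<close>

lemma taylor_hom_not_constant:
  assumes "\<not> taylor_series_in_r2 F"
  shows "\<exists>N. \<not> (\<exists>c. \<forall>\<theta>. taylor_hom F N (cis \<theta>) = c)"
proof (rule ccontr)
  assume "\<nexists>N. \<not> (\<exists>c. \<forall>\<theta>. taylor_hom F N (cis \<theta>) = c)"
  then obtain c where c: "\<And>N \<theta>. taylor_hom F N (cis \<theta>) = c N" by metis
  have "(\<Sum>i\<le>N. taylor_coeff F i (N - i) * u ^ i * v ^ (N - i)) =
      (if even N then c (2 * (N div 2)) * (u\<^sup>2 + v\<^sup>2) ^ (N div 2) else 0)" for N u v
  proof -
    define z where "z = Complex u v"
    have "of_real (cmod z) * cis (Arg z) = z"
      using rcis_cmod_Arg[of z] by (simp add: rcis_def)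
    then have "taylor_hom F N z = cmod z ^ N * c N"
      using taylor_hom_scale[of F N "cmod z" "cis (Arg z)"] by (simp only: c)
    then have sum: "(\<Sum>i\<le>N. taylor_coeff F i (N - i) * u ^ i * v ^ (N - i)) = cmod z ^ N * c N"
      by (simp add: taylor_hom_def z_def)
    show ?thesis
    proof (cases "even N")
      case True
      then have "cmod z ^ N = (cmod z ^ 2) ^ (N div 2)" by (simp flip: power_mult)
      also have "cmod z ^ 2 = u\<^sup>2 + v\<^sup>2" by (simp add: z_def cmod_power2)
      finally show ?thesis using sum True by simp
    next
      case False
      have "taylor_hom F N (of_real (- 1) * cis 0) = - c N"
        using False by (simp only: taylor_hom_scale c) simp
      moreover have "of_real (- 1) * cis 0 = cis pi" by simp
      ultimately have "c N = 0" using c[of N pi] by simp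
      then show ?thesis using sum False by simp
    qed
  qed
  then have "taylor_series_in_r2 F"
    unfolding taylor_series_in_r2_def by (intro exI[of _ "\<lambda>n. c (2 * n)"]) simp
  with assms show False by simp
qed

section \<open>Continuity, slices and the identity theorem for analytic functions\<close>

lemma real_analytic2_at_isCont:
  fixes \<Xi> :: "real \<Rightarrow> real \<Rightarrow> real"
  assumes "real_analytic2_at \<Xi> x y"
  shows "isCont (\<lambda>z. \<Xi> (Re z) (Im z)) (Complex x y)"
proof -
  obtain a r where r: "r > 0"
    and \<Xi>: "\<And>s t. \<bar>s\<bar> < r \<and> \<bar>t\<bar> < r \<Longrightarrow>
        ((\<lambda>(i, j). (s ^ i * t ^ j) *\<^sub>R a i j) has_sum \<Xi> (x + s) (y + t)) UNIV"
    using assms unfolding real_analytic2_at_def by auto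
  have "smooth_on (\<lambda>z. \<Xi> (x + Re z) (y + Im z)) {z. \<bar>Re z\<bar> < r \<and> \<bar>Im z\<bar> < r}"
    by (rule power_series2_smooth_on[where a = a]) (use \<Xi> in auto)
  then have "isCont (\<lambda>z. \<Xi> (x + Re z) (y + Im z)) 0"
    using smooth_on_continuous_on r by (fastforce simp: continuous_on_eq_continuous_at[OF open_square])
  then have "isCont ((\<lambda>z. \<Xi> (x + Re z) (y + Im z)) \<circ> (\<lambda>z. z - Complex x y)) (Complex x y)"
    by (intro continuous_at_compose) auto
  then show ?thesis by (simp add: o_def)
qed

text \<open>Setting the first increment to 0 leaves the terms with \<open>i = 0\<close>, because
  \<open>0 ^ 0 = 1\<close> and the other powers vanish.\<close>

lemma real_analytic2_at_slice:
  fixes \<Xi> :: "real \<Rightarrow> real \<Rightarrow> real"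
  assumes "real_analytic2_at \<Xi> x t"
  shows "\<exists>b r. 0 < r \<and> (\<forall>y. \<bar>y\<bar> < r \<longrightarrow> (\<lambda>j. b j * y ^ j) sums \<Xi> x (t + y))"
proof -
  obtain a r where r: "r > 0"
    and \<Xi>: "\<And>s y. \<bar>s\<bar> < r \<and> \<bar>y\<bar> < r \<Longrightarrow>
        ((\<lambda>(i, j). (s ^ i * y ^ j) *\<^sub>R a i j) has_sum \<Xi> (x + s) (t + y)) UNIV"
    using assms unfolding real_analytic2_at_def by auto
  have "(\<lambda>j. a 0 j * y ^ j) sums \<Xi> x (t + y)" if "\<bar>y\<bar> < r" for y
  proof -
    have bij: "bij_betw (Pair 0) UNIV {(i :: nat, j :: nat). i = 0}"
      by (rule bij_betwI[where g = snd]) auto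
    have "((\<lambda>(i, j). (0 ^ i * y ^ j) *\<^sub>R a i j) has_sum \<Xi> x (t + y)) UNIV"
      using \<Xi>[of 0 y] that r by simp
    then have "((\<lambda>(i, j). (0 ^ i * y ^ j) *\<^sub>R a i j) has_sum \<Xi> x (t + y)) {(i, j). i = 0}"
      by (rule has_sum_cong_neutral[THEN iffD1, rotated -1]) auto
    then have "((\<lambda>j. a 0 j * y ^ j) has_sum \<Xi> x (t + y)) UNIV"
      using has_sum_reindex_bij_betw[OF bij, of "\<lambda>(i, j). (0 ^ i * y ^ j) *\<^sub>R a i j"]
      by (simp add: mult.commute)
    then show ?thesis by (rule has_sum_imp_sums)
  qed
  with r show ?thesis by (intro exI[of _ "a 0"] exI[of _ r]) auto
qed

text \<open>The interior of the zero set is closed as well as open: a point of its closure is a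
  non-isolated zero, so the local power series there vanishes. Connectedness of the line does the
  rest.\<close>

lemma real_analytic_identity:
  fixes f :: "real \<Rightarrow> real"
  assumes cont: "continuous_on UNIV f"
    and f: "\<And>t. \<exists>b r. 0 < r \<and> (\<forall>y. \<bar>y\<bar> < r \<longrightarrow> (\<lambda>j. b j * y ^ j) sums f (t + y))"
    and "0 < e" and zero: "\<And>t. \<bar>t - t0\<bar> < e \<Longrightarrow> f t = 0"
  shows "f t = 0"
proof -
  define Z where "Z = {t. f t = 0}"
  have clZ: "closed Z"
    unfolding Z_def using cont by (intro closed_Collect_eq) auto
  have "t \<in> interior Z" if t: "t \<in> closure (interior Z)" for t
  proof -
    have "t \<in> Z"
      using t clZ closure_minimal[OF interior_subset clZ] by blast
    then have ft: "f t = 0" by (simp add: Z_def)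
    have "t islimpt Z"
    proof (cases "t \<in> interior Z")
      case True
      then show ?thesis by (rule interior_limit_point)
    next
      case False
      then have "t islimpt interior Z" using t by (simp add: closure_def)
      then show ?thesis using islimpt_subset interior_subset by blast
    qed
    then have lim: "\<exists>x\<in>Z. x \<noteq> t \<and> dist x t < s" if "s > 0" for s
      using that islimpt_approachable by blast
    obtain b r where r: "0 < r" and b: "\<And>y. \<bar>y\<bar> < r \<Longrightarrow> (\<lambda>j. b j * y ^ j) sums f (t + y)"
      using f by metis
    \<comment> \<open>A nonzero coefficient of positive index would make \<open>t\<close> an
      isolated zero. The remaining coefficient \<open>b 0\<close> equals
      \<open>f t = 0\<close>.\<close>
    have b0: "b m = 0" if m: "m > 0" for m
    proof (rule ccontr)
      assume "b m \<noteq> 0"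
      then obtain s where s: "0 < s" "\<And>x. x \<in> cball t s - {t} \<Longrightarrow> f x \<noteq> 0"
        using powser_0_nonzero[where \<xi> = t and f = f and a = b and m = m, OF r _ ft _ m]
          b[of "x - t" for x] by (metis add_diff_cancel_left' diff_add_cancel add.commute real_norm_def)
      then show False
        using lim[of s] by (auto simp: Z_def dist_commute)
    qed
    have "f (t + y) = 0" if y: "\<bar>y\<bar> < r" for y
    proof -
      have eq: "(\<lambda>j. b j * y ^ j) = (\<lambda>j. if j = 0 then b 0 else 0)" for y
        using b0 by auto
      have val: "f (t + y) = b 0" if "\<bar>y\<bar> < r" for y
        using sums_unique2[OF b[OF that, unfolded eq]] sums_single[of 0 "\<lambda>_. b 0"] by simp
      show ?thesis using val[of 0] val[OF y] r ft by simp
    qed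
    then have "ball t r \<subseteq> Z"
      unfolding Z_def by (auto simp: dist_real_def) (metis abs_minus_commute add.commute diff_add_cancel)
    then show ?thesis using r by (meson centre_in_ball interior_maximal open_ball subsetD)
  qed
  then have "closed (interior Z)" by (metis closure_subset closure_subset_eq subsetI)
  then have "interior Z = {} \<or> interior Z = UNIV" using clopen open_interior by blast
  moreover have "ball t0 e \<subseteq> interior Z"
    using zero by (intro interior_maximal) (auto simp: Z_def dist_real_def abs_minus_commute)
  ultimately have "interior Z = UNIV" using \<open>0 < e\<close> by auto
  then have "t \<in> Z" using interior_subset by blast
  then show ?thesis by (simp add: Z_def)
qed

section \<open>First integrals and rotations\<close>

lemma has_derivative_cis_circle:
  assumes "(G has_derivative (\<lambda>h. Re h * A + Im h * B)) (at (of_real r * cis \<theta>))"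
  shows "((\<lambda>\<theta>. G (of_real r * cis \<theta>)) has_real_derivative r * (cos \<theta> * B - sin \<theta> * A)) (at \<theta>)"
proof -
  have c: "((\<lambda>\<theta>. of_real r * cis \<theta>) has_derivative (\<lambda>h. of_real r * (h *\<^sub>R (\<i> * cis \<theta>)))) (at \<theta>)"
    by (auto intro!: derivative_eq_intros simp: fun_eq_iff complex_eq_iff)
  show ?thesis
    unfolding has_field_derivative_def
    by (rule has_derivative_eq_rhs[OF has_derivative_compose[OF c assms]]) (simp add: fun_eq_iff algebra_simps)
qed

lemma add_period_multiple:
  fixes f :: "real \<Rightarrow> 'a"
  assumes "\<And>t. f (t + a) = f t"
  shows "f (t + real k * a) = f t"
proof (induction k)
  case (Suc k)
  have "f (t + real (Suc k) * a) = f (t + real k * a + a)" by (simp add: algebra_simps)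
  then show ?case using assms Suc by simp
qed simp

text \<open>The shift by \<open>a\<close> permutes the summands cyclically, since
  \<open>real q * a\<close> is a period.\<close>

lemma sum_shift_periodic:
  fixes f :: "real \<Rightarrow> real"
  assumes "\<And>t. f (t + real q * a) = f t"
  shows "(\<Sum>j<q. f (t + a + real j * a)) = (\<Sum>j<q. f (t + real j * a))"
proof -
  have "(\<Sum>j<q. f (t + a + real j * a)) = (\<Sum>j<q. f (t + real (Suc j) * a))"
    by (rule sum.cong) (simp_all add: algebra_simps)
  moreover have "(\<Sum>j<Suc q. f (t + real j * a)) = f t + (\<Sum>j<q. f (t + real (Suc j) * a))"
    by (subst sum.lessThan_Suc_shift) simp
  ultimately show ?thesis using assms[of t] by simp
qed

text \<open>The argument in the normal form coordinate, with \<open>F\<close> the second integral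
  read there. \<open>F\<close> is used through finite Taylor expansions; analyticity of
  \<open>\<Xi>\<close> carries the conclusion from an interval of angles to all angles.\<close>

lemma rotation_of_first_integral:
  fixes F :: "complex \<Rightarrow> real" and \<Xi> :: "real \<Rightarrow> real \<Rightarrow> real" and p q :: nat
  defines "\<alpha> \<equiv> 2 * pi * real p / real q"
  assumes S: "open S" "0 \<in> S" and F: "smooth_on F S"
    and not_r2: "\<not> taylor_series_in_r2 F"
    and q: "q > 0" and \<rho>: "\<rho> > 0"
    and analytic: "\<And>r \<theta>. \<bar>r\<bar> < \<rho> \<Longrightarrow> real_analytic2_at \<Xi> r \<theta>"
    and periodic: "\<And>r \<theta>. \<bar>r\<bar> < \<rho> \<Longrightarrow> \<Xi> r (\<theta> + 2 * pi / real q) = \<Xi> r \<theta>"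
    and \<Xi>0: "\<And>\<theta>. \<Xi> 0 \<theta> = \<alpha>"
    and invariant: "\<And>r \<theta>. 0 \<le> r \<Longrightarrow> r < \<rho> \<Longrightarrow>
        F (of_real r * cis (\<theta> + \<Xi> r \<theta>)) = F (of_real r * cis \<theta>)"
  shows "\<exists>\<epsilon>>0. \<forall>r \<theta>. 0 \<le> r \<and> r < \<epsilon> \<longrightarrow> \<Xi> r \<theta> = \<alpha>"
proof -

  \<comment> \<open>The leading non-radial Taylor component\<close>
  define N where "N = (LEAST N. \<not> (\<exists>c. \<forall>\<theta>. taylor_hom F N (cis \<theta>) = c))"
  define P where "P \<theta> = taylor_hom F N (cis \<theta>)" for \<theta>
  have P_nonconst: "\<not> (\<exists>c. \<forall>\<theta>. P \<theta> = c)"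
    unfolding P_def N_def by (rule LeastI_ex) (rule taylor_hom_not_constant[OF not_r2])
  have "\<exists>c. \<forall>\<theta>. taylor_hom F m (cis \<theta>) = c" if "m < N" for m
    using not_less_Least that unfolding N_def by blast
  then obtain c where c: "\<And>m \<theta>. m < N \<Longrightarrow> taylor_hom F m (cis \<theta>) = c m" by metis
  \<comment> \<open>The degree 0 component is the constant \<open>F 0\<close>. With
    \<open>N = Suc n\<close> the gradient of the degree \<open>N\<close> remainder is given by
    degree \<open>n\<close> remainders.\<close>
  have "N \<noteq> 0"
  proof
    assume "N = 0"
    then have "\<forall>\<theta>. P \<theta> = F 0" by (simp add: P_def taylor_hom_0)
    with P_nonconst show False by blast
  qed
  then obtain n where n: "N = Suc n" using not0_implies_Suc by blast

  define R where "R = taylor_remainder F N"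
  \<comment> \<open>The components below degree \<open>N\<close> are constant on circles around 0
    and make up the radial part \<open>K r\<close>.\<close>
  define K where "K r = (\<Sum>m<N. r ^ m * c m)" for r
  have expansion: "F (of_real r * cis \<theta>) = K r + r ^ N * P \<theta> + R (of_real r * cis \<theta>)" for r \<theta>
  proof -
    have "(\<Sum>m\<le>N. taylor_hom F m (of_real r * cis \<theta>)) = K r + r ^ N * P \<theta>"
      by (simp add: taylor_hom_scale c K_def P_def lessThan_Suc_atMost[symmetric])
    then show ?thesis by (simp add: R_def taylor_remainder_def)
  qed

  \<comment> \<open>\<open>A\<close> and \<open>B\<close> are the partial derivatives of
    \<open>R\<close>; the bound for degree \<open>n\<close> has exponent
    \<open>Suc n = N\<close>.\<close>
  define A where "A = taylor_remainder (dir_deriv 1 F) n"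
  define B where "B = taylor_remainder (dir_deriv \<i> F) n"
  have R_deriv: "(R has_derivative (\<lambda>h. Re h * A z + Im h * B z)) (at z)" if "z \<in> S" for z
    unfolding R_def A_def B_def n by (rule has_derivative_taylor_remainder_Suc[OF S that F])
  obtain r0 where r0: "r0 > 0" "ball 0 r0 \<subseteq> S" using S openE by blast
  obtain C1 r1 where 1: "0 \<le> C1" "0 < r1" "\<And>z. cmod z < r1 \<Longrightarrow> \<bar>R z\<bar> \<le> C1 * cmod z ^ Suc N"
    unfolding R_def using taylor_remainder_bound[OF S F] by meson
  obtain C2 r2 where 2: "0 \<le> C2" "0 < r2" "\<And>z. cmod z < r2 \<Longrightarrow> \<bar>A z\<bar> \<le> C2 * cmod z ^ N"
    unfolding A_def n using taylor_remainder_bound[OF S smooth_on_dir_deriv[OF F]] by meson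
  obtain C3 r3 where 3: "0 \<le> C3" "0 < r3" "\<And>z. cmod z < r3 \<Longrightarrow> \<bar>B z\<bar> \<le> C3 * cmod z ^ N"
    unfolding B_def n using taylor_remainder_bound[OF S smooth_on_dir_deriv[OF F]] by meson
  define \<sigma> where "\<sigma> = min (min \<rho> r0) (min r1 (min r2 r3))"
  have \<sigma>: "0 < \<sigma>" "\<sigma> \<le> \<rho>" "\<sigma> \<le> r0" "\<sigma> \<le> r1" "\<sigma> \<le> r2" "\<sigma> \<le> r3"
    using \<rho> r0(1) 1(2) 2(2) 3(2) by (simp_all add: \<sigma>_def)

  \<comment> \<open>The tangential derivative along the unit circle, in a form that shows its
    continuity.\<close>
  define P' where "P' \<theta> = cos \<theta> * taylor_hom (dir_deriv \<i> F) n (cis \<theta>)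
    - sin \<theta> * taylor_hom (dir_deriv 1 F) n (cis \<theta>)" for \<theta>
  have P': "(P has_real_derivative P' \<theta>) (at \<theta>)" for \<theta>
    using has_derivative_cis_circle[OF has_derivative_taylor_hom[OF S F, of n "of_real 1 * cis \<theta>"]]
    by (simp add: P_def[abs_def] P'_def n)
  have P_cont: "isCont P \<theta>" for \<theta> using P' DERIV_isCont by blast
  have P'_cont: "isCont P' \<theta>" for \<theta>
    unfolding P'_def taylor_hom_def by (intro continuous_intros) auto

  \<comment> \<open>The angular displacement as r tends to 0\<close>
  have \<Xi>_cont: "isCont (\<lambda>z. \<Xi> (Re z) (Im z)) (Complex r \<theta>)" if "\<bar>r\<bar> < \<rho>" for r \<theta>
    by (rule real_analytic2_at_isCont[OF analytic[OF that]])
  have \<Xi>_lim: "((\<lambda>r. \<Xi> r \<theta>) \<longlongrightarrow> \<alpha>) (at_right 0)" for \<theta>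
  proof -
    have "isCont (\<lambda>r. Complex r \<theta>) 0" unfolding isCont_def by (intro tendsto_intros)
    from isCont_o2[OF this \<Xi>_cont] have "isCont (\<lambda>r. \<Xi> r \<theta>) 0" using \<rho> by simp
    then show ?thesis
      unfolding isCont_def using \<Xi>0 by (metis at_le subset_UNIV tendsto_mono)
  qed

  \<comment> \<open>Invariance cancels the radial part \<open>K r\<close>; division by
    \<open>r ^ N\<close> leaves two remainders of size at most \<open>C1 * r\<close>, which vanish
    in the limit.\<close>
  have P_periodic: "P (\<theta> + \<alpha>) = P \<theta>" for \<theta>
  proof -
    have "((\<lambda>r. P (\<theta> + \<Xi> r \<theta>) - P \<theta>) \<longlongrightarrow> P (\<theta> + \<alpha>) - P \<theta>) (at_right 0)"
      by (intro tendsto_intros isCont_tendsto_compose[OF P_cont] \<Xi>_lim)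
    moreover have "((\<lambda>r. P (\<theta> + \<Xi> r \<theta>) - P \<theta>) \<longlongrightarrow> 0) (at_right 0)"
    proof (rule Lim_null_comparison)
      show "\<forall>\<^sub>F r in at_right 0. norm (P (\<theta> + \<Xi> r \<theta>) - P \<theta>) \<le> 2 * C1 * r"
        unfolding eventually_at_right_field
      proof (intro exI[of _ \<sigma>] conjI allI impI \<sigma>(1))
        fix r :: real assume r: "0 < r" "r < \<sigma>"
        have "r ^ N * (P (\<theta> + \<Xi> r \<theta>) - P \<theta>) = R (of_real r * cis \<theta>) - R (of_real r * cis (\<theta> + \<Xi> r \<theta>))"
          using invariant[of r \<theta>] r \<sigma> expansion[of r \<theta>] expansion[of r "\<theta> + \<Xi> r \<theta>"]
          by (simp add: algebra_simps)
        moreover have "\<bar>R (of_real r * cis t)\<bar> \<le> C1 * r ^ Suc N" for t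
          using 1(3)[of "of_real r * cis t"] r \<sigma> by (simp add: norm_mult)
        then have "\<bar>R (of_real r * cis \<theta>) - R (of_real r * cis (\<theta> + \<Xi> r \<theta>))\<bar> \<le> 2 * (C1 * r ^ Suc N)"
          by (smt (verit))
        ultimately have "\<bar>r ^ N * (P (\<theta> + \<Xi> r \<theta>) - P \<theta>)\<bar> \<le> 2 * (C1 * r ^ Suc N)" by simp
        then have "r ^ N * \<bar>P (\<theta> + \<Xi> r \<theta>) - P \<theta>\<bar> \<le> r ^ N * (2 * C1 * r)"
          using r by (simp only: abs_mult power_abs abs_of_pos power_Suc mult_ac)
        then show "norm (P (\<theta> + \<Xi> r \<theta>) - P \<theta>) \<le> 2 * C1 * r"
          using r by simp
      qed
      show "((\<lambda>r. 2 * C1 * r) \<longlongrightarrow> 0) (at_right 0)"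
        using tendsto_mult_left[OF tendsto_ident_at, of "2 * C1" 0 "{0<..}"] by simp
    qed
    ultimately have "P (\<theta> + \<alpha>) - P \<theta> = 0"
      using tendsto_unique trivial_limit_at_right_real by blast
    then show ?thesis by simp
  qed
  note P_shift = add_period_multiple[of P, OF P_periodic]

  \<comment> \<open>\<open>\<alpha>\<close> is \<open>p\<close> times the period
    \<open>2 * pi / real q\<close>, so \<open>j\<close> rotations make \<open>j * p\<close>
    periods.\<close>
  have \<Xi>_shift: "\<Xi> r (\<theta> + real j * \<alpha>) = \<Xi> r \<theta>" if "\<bar>r\<bar> < \<rho>" for r \<theta> j
    using add_period_multiple[of "\<Xi> r" "2 * pi / real q" \<theta> "j * p"] periodic[OF that]
    by (simp add: \<alpha>_def mult_ac)

  text \<open>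
    Averaging over the rotation by \<open>\<alpha>\<close> turns an integral of the map into an integral of the map
    followed by the inverse rotation, whose angular displacement \<open>\<Xi> r \<theta> - \<alpha>\<close> tends to \<open>0\<close>.
  \<close>
  define \<Phi> where "\<Phi> r \<theta> = (\<Sum>j<q. F (of_real r * cis (\<theta> + real j * \<alpha>)))" for r \<theta>
  have \<Phi>_invariant: "\<Phi> r (\<theta> + (\<Xi> r \<theta> - \<alpha>)) = \<Phi> r \<theta>" if r: "0 \<le> r" "r < \<rho>" for r \<theta>
  proof -
    have "cis (t + real q * \<alpha>) = cis t" for t
    proof -
      have "real q * \<alpha> = 2 * pi * real p" using q by (simp add: \<alpha>_def)
      then show ?thesis by (simp add: cis_mult[symmetric] cis_multiple_2pi)
    qed
    then have "\<Phi> r (t + \<alpha>) = \<Phi> r t" for t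
      unfolding \<Phi>_def by (intro sum_shift_periodic[of "\<lambda>t. F (of_real r * cis t)"]) simp
    from this[of "\<theta> + (\<Xi> r \<theta> - \<alpha>)"] have "\<Phi> r (\<theta> + (\<Xi> r \<theta> - \<alpha>)) = \<Phi> r (\<theta> + \<Xi> r \<theta>)"
      by simp
    \<comment> \<open>Invariance applies to each summand, because all the rotated angles have the
      same displacement \<open>\<Xi> r \<theta>\<close>.\<close>
    also have "\<dots> = \<Phi> r \<theta>"
      unfolding \<Phi>_def
    proof (rule sum.cong)
      fix j
      show "F (of_real r * cis (\<theta> + \<Xi> r \<theta> + real j * \<alpha>)) = F (of_real r * cis (\<theta> + real j * \<alpha>))"
        using invariant[OF r, of "\<theta> + real j * \<alpha>"] r \<Xi>_shift[of r \<theta> j] by (simp add: add_ac)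
    qed simp
    finally show ?thesis .
  qed

  \<comment> \<open>The contribution of \<open>R\<close> to the angular derivative of
    \<open>\<Phi>\<close>.\<close>
  define E where "E r \<theta> = (\<Sum>j<q. r * (cos (\<theta> + real j * \<alpha>) * B (of_real r * cis (\<theta> + real j * \<alpha>))
      - sin (\<theta> + real j * \<alpha>) * A (of_real r * cis (\<theta> + real j * \<alpha>))))" for r \<theta>
  have \<Phi>_deriv: "(\<Phi> r has_real_derivative real q * r ^ N * P' \<theta> + E r \<theta>) (at \<theta>)"
    if r: "0 \<le> r" "r < \<sigma>" for r \<theta>
  proof -
    \<comment> \<open>As \<open>P\<close> has period \<open>\<alpha>\<close>, the \<open>q\<close>
      leading terms coincide and cannot cancel in the average.\<close>
    have eq: "\<Phi> r = (\<lambda>\<theta>. real q * K r + real q * r ^ N * P \<theta>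
        + (\<Sum>j<q. R (of_real r * cis (\<theta> + real j * \<alpha>))))"
      unfolding \<Phi>_def expansion P_shift by (simp add: sum.distrib fun_eq_iff distrib_left)
    have circle: "((\<lambda>\<theta>. R (of_real r * cis \<theta>)) has_real_derivative
        r * (cos t * B (of_real r * cis t) - sin t * A (of_real r * cis t))) (at t)" for t
    proof (rule has_derivative_cis_circle[OF R_deriv])
      show "of_real r * cis t \<in> S" using r \<sigma> r0(2) by (auto simp: norm_mult subset_eq)
    qed
    have "((\<lambda>\<theta>. R (of_real r * cis (\<theta> + real j * \<alpha>))) has_real_derivative
        r * (cos (\<theta> + real j * \<alpha>) * B (of_real r * cis (\<theta> + real j * \<alpha>))
           - sin (\<theta> + real j * \<alpha>) * A (of_real r * cis (\<theta> + real j * \<alpha>)))) (at \<theta>)" for j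
      using circle[of "\<theta> + real j * \<alpha>"] DERIV_shift[of "\<lambda>\<theta>. R (of_real r * cis \<theta>)"] by blast
    then have "((\<lambda>\<theta>. real q * K r + real q * r ^ N * P \<theta>
        + (\<Sum>j<q. R (of_real r * cis (\<theta> + real j * \<alpha>)))) has_real_derivative
        0 + real q * r ^ N * P' \<theta> + E r \<theta>) (at \<theta>)"
      unfolding E_def by (intro DERIV_add DERIV_const DERIV_cmult P' DERIV_sum)
    then show ?thesis unfolding eq by simp
  qed
  define C where "C = C2 + C3"
  \<comment> \<open>One factor \<open>r\<close> is the speed of the circle parametrisation, the
    factor \<open>r ^ N\<close> the size of \<open>A\<close> and \<open>B\<close>; so
    \<open>E\<close> is one order smaller than the leading term.\<close>
  have E_bound: "\<bar>E r \<theta>\<bar> \<le> real q * (r * (C * r ^ N))" if r: "0 \<le> r" "r < \<sigma>" for r \<theta>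
  proof -
    have "\<bar>r * (cos t * B (of_real r * cis t) - sin t * A (of_real r * cis t))\<bar> \<le> r * (C * r ^ N)" for t
    proof -
      have A: "\<bar>A (of_real r * cis t)\<bar> \<le> C2 * r ^ N" and B: "\<bar>B (of_real r * cis t)\<bar> \<le> C3 * r ^ N"
        using 2(3)[of "of_real r * cis t"] 3(3)[of "of_real r * cis t"] r \<sigma> by (simp_all add: norm_mult)
      have "\<bar>cos t * B (of_real r * cis t)\<bar> \<le> 1 * (C3 * r ^ N)"
        unfolding abs_mult by (rule mult_mono[OF _ B]) simp_all
      moreover have "\<bar>sin t * A (of_real r * cis t)\<bar> \<le> 1 * (C2 * r ^ N)"
        unfolding abs_mult by (rule mult_mono[OF _ A]) simp_all
      ultimately have "\<bar>cos t * B (of_real r * cis t) - sin t * A (of_real r * cis t)\<bar> \<le> C * r ^ N"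
        by (simp add: C_def algebra_simps)
      then show ?thesis using r by (simp add: abs_mult mult_left_mono)
    qed
    then have "\<bar>E r \<theta>\<bar> \<le> (\<Sum>j<q. r * (C * r ^ N))"
      unfolding E_def by (intro order_trans[OF sum_abs] sum_mono)
    then show ?thesis by simp
  qed

  \<comment> \<open>Vanishing of the displacement near one angle\<close>
  obtain \<theta>0 where \<theta>0: "P' \<theta>0 \<noteq> 0"
    using P_nonconst P' DERIV_isconst_all by metis
  \<comment> \<open>With half of the modulus of \<open>P' \<theta>0\<close> as tolerance, the
    modulus of \<open>P'\<close> stays above \<open>e\<close> within \<open>\<delta>\<close> of
    \<open>\<theta>0\<close>.\<close>
  define e where "e = \<bar>P' \<theta>0\<bar> / 2"
  have e: "e > 0" using \<theta>0 by (simp add: e_def)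
  obtain \<delta> where \<delta>: "\<delta> > 0" and P'_near: "\<And>t. \<bar>t - \<theta>0\<bar> < \<delta> \<Longrightarrow> \<bar>P' t - P' \<theta>0\<bar> < e"
    using P'_cont[of \<theta>0] e unfolding continuous_at_eps_delta dist_real_def by metis
  have "isCont (\<lambda>z. \<Xi> (Re z) (Im z)) (Complex 0 \<theta>0)" using \<Xi>_cont \<rho> by simp
  then obtain \<eta> where \<eta>: "\<eta> > 0" and \<Xi>_near:
    "\<And>z. cmod (z - Complex 0 \<theta>0) < \<eta> \<Longrightarrow> \<bar>\<Xi> (Re z) (Im z) - \<alpha>\<bar> < \<delta> / 2"
    unfolding continuous_at_eps_delta dist_norm real_norm_def complex.sel \<Xi>0
    using half_gt_zero[OF \<delta>] by blast
  \<comment> \<open>The last bound yields \<open>r * C < e\<close>, with \<open>C + 1\<close>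
    preventing a zero denominator. The two bounds \<open>\<eta> / 2\<close> keep the point within
    \<open>\<eta>\<close> of \<open>Complex 0 \<theta>0\<close>, and \<open>\<delta> / 2\<close> in
    \<open>\<kappa>\<close> leaves room for the displacement.\<close>
  define \<epsilon> where "\<epsilon> = min \<sigma> (min (\<eta> / 2) (e / (C + 1)))"
  define \<kappa> where "\<kappa> = min (\<delta> / 2) (\<eta> / 2)"
  have C: "0 \<le> C" using 2(1) 3(1) by (simp add: C_def)
  have pos: "\<epsilon> > 0" "\<kappa> > 0" using \<sigma> \<eta> e \<delta> C by (simp_all add: \<epsilon>_def \<kappa>_def)
  have local: "\<Xi> r \<theta> - \<alpha> = 0" if r: "0 \<le> r" "r < \<epsilon>" and \<theta>: "\<bar>\<theta> - \<theta>0\<bar> < \<kappa>" for r \<theta>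
  proof (cases "r = 0")
    case False
    with r have r': "0 < r" "r < \<sigma>" "r < \<rho>" "r < \<eta> / 2" "r < e / (C + 1)"
      using \<sigma> by (auto simp: \<epsilon>_def)
    have "cmod (Complex r \<theta> - Complex 0 \<theta>0) \<le> \<bar>r\<bar> + \<bar>\<theta> - \<theta>0\<bar>"
      using cmod_le[of "Complex r \<theta> - Complex 0 \<theta>0"] by simp
    also have "\<dots> < \<eta>" using r' \<theta> by (simp add: \<kappa>_def)
    finally have small: "\<bar>\<Xi> r \<theta> - \<alpha>\<bar> < \<delta> / 2" using \<Xi>_near by fastforce
    \<comment> \<open>Dividing a zero by \<open>real q * r ^ N\<close> would make the modulus of
      \<open>P' t\<close> at most \<open>r * C\<close>, hence below \<open>e\<close>.\<close>
    have nonzero: "real q * r ^ N * P' t + E r t \<noteq> 0" if t: "\<bar>t - \<theta>0\<bar> < \<delta>" for t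
    proof
      assume "real q * r ^ N * P' t + E r t = 0"
      then have "\<bar>real q * r ^ N * P' t\<bar> = \<bar>E r t\<bar>" by linarith
      also have "\<dots> \<le> real q * (r * (C * r ^ N))" using E_bound r' by simp
      finally have "(real q * r ^ N) * \<bar>P' t\<bar> \<le> (real q * r ^ N) * (r * C)"
        using r' by (simp add: abs_mult mult_ac)
      moreover have "0 < real q * r ^ N" using q r' by simp
      ultimately have "\<bar>P' t\<bar> \<le> r * C" by (rule mult_left_le_imp_le)
      also have "\<dots> \<le> r * (C + 1)" using r' by simp
      also have "\<dots> < e" using r' C by (simp add: pos_less_divide_eq)
      finally have "\<bar>P' t\<bar> < e" .
      then show False using P'_near[OF t] unfolding e_def by linarith
    qed
    show ?thesis
    proof (rule ccontr)
      assume ne: "\<Xi> r \<theta> - \<alpha> \<noteq> 0"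
      \<comment> \<open>The displacement may have either sign, so the endpoints are put in order.
        \<open>\<Phi> r\<close> agrees at both, and the mean value theorem acts as Rolle's
        theorem.\<close>
      define a where "a = min \<theta> (\<theta> + (\<Xi> r \<theta> - \<alpha>))"
      define b where "b = max \<theta> (\<theta> + (\<Xi> r \<theta> - \<alpha>))"
      have ab: "a < b" using ne by (auto simp: a_def b_def)
      have "\<Phi> r a = \<Phi> r b"
        using \<Phi>_invariant[of r \<theta>] r' by (auto simp: a_def b_def min_def max_def)
      then obtain t where t: "a < t" "t < b" and "real q * r ^ N * P' t + E r t = 0"
        using MVT2[OF ab, of "\<Phi> r" "\<lambda>t. real q * r ^ N * P' t + E r t"] \<Phi>_deriv[of r] r' ab by auto
      moreover have "\<bar>t - \<theta>0\<bar> < \<delta>"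
        using t small \<theta> unfolding a_def b_def \<kappa>_def by (auto simp: min_def max_def abs_if split: if_splits)
      ultimately show False using nonzero by blast
    qed
  qed (use \<Xi>0 in simp)

  \<comment> \<open>Extension to all angles\<close>
  have "\<Xi> r \<theta> = \<alpha>" if r: "0 \<le> r" "r < \<epsilon>" for r \<theta>
  proof -
    have r\<rho>: "\<bar>r\<bar> < \<rho>" using r \<sigma> by (simp add: \<epsilon>_def)
    have "\<Xi> r \<theta> - \<alpha> = 0"
    proof (rule real_analytic_identity[of "\<lambda>\<theta>. \<Xi> r \<theta> - \<alpha>", OF _ _ pos(2) local[OF r]])
      have "isCont (\<lambda>\<theta>. \<Xi> r \<theta>) t" for t
      proof -
        have "isCont (\<lambda>\<theta>. Complex r \<theta>) t" unfolding isCont_def by (intro tendsto_intros)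
        from isCont_o2[OF this \<Xi>_cont[OF r\<rho>]] show ?thesis by simp
      qed
      then show "continuous_on UNIV (\<lambda>\<theta>. \<Xi> r \<theta> - \<alpha>)"
        by (intro continuous_at_imp_continuous_on ballI continuous_intros)
      fix t
      obtain b s where s: "0 < s" "\<And>y. \<bar>y\<bar> < s \<Longrightarrow> (\<lambda>j. b j * y ^ j) sums \<Xi> r (t + y)"
        using real_analytic2_at_slice[OF analytic[OF r\<rho>, of t]] by blast
      \<comment> \<open>Subtracting \<open>\<alpha>\<close> changes only the constant coefficient of
        the local series.\<close>
      have "(\<lambda>j. (b j - (if j = 0 then \<alpha> else 0)) * y ^ j) sums (\<Xi> r (t + y) - \<alpha>)" if "\<bar>y\<bar> < s" for y
      proof -
        have "(\<lambda>j. b j * y ^ j - (if j = 0 then \<alpha> else 0)) sums (\<Xi> r (t + y) - \<alpha>)"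
          using sums_diff[OF s(2)[OF that] sums_single[of 0 "\<lambda>_. \<alpha>"]] by simp
        moreover have "(\<lambda>j. b j * y ^ j - (if j = 0 then \<alpha> else 0)) =
            (\<lambda>j. (b j - (if j = 0 then \<alpha> else 0)) * y ^ j)" by (simp add: fun_eq_iff)
        ultimately show ?thesis by simp
      qed
      then show "\<exists>b s. 0 < s \<and> (\<forall>y. \<bar>y\<bar> < s \<longrightarrow> (\<lambda>j. b j * y ^ j) sums (\<Xi> r (t + y) - \<alpha>))"
        using s(1) by (intro exI[of _ "\<lambda>j. b j - (if j = 0 then \<alpha> else 0)"] exI[of _ s]) simp
    qed
    then show ?thesis by simp
  qed
  then show ?thesis using pos(1) by blast
qed

section \<open>Transfer to normal form coordinates and the conjugacy\<close>

theorem corollary4p4: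
  fixes f :: "complex \<Rightarrow> complex" and I1 I2 :: "complex \<Rightarrow> real"
    and U :: "complex set" and p q :: nat and W V :: "complex \<Rightarrow> complex"
  assumes f_analytic: "real_analytic_at f 0"
    and pq: "coprime p q" "q \<ge> 3"
    and elliptic: "elliptic_fixed_point f (real p / real q)"
    and linear: "\<And>z. linear_part f z = cis (2 * pi * (real p / real q)) * z"
    and U: "open U" "0 \<in> U"
    and I1: "\<And>z. z \<in> U \<Longrightarrow> real_analytic_at I1 z" "first_integral f I1"
      "nondegenerate_local_min I1"
    and I2: "smooth_on I2 U" "first_integral f I2"
    and normal_form: "normal_form_coordinates f I1 p q W V"
    and I2_taylor: "\<not> taylor_series_in_r2 (\<lambda>w. I2 (V w))"
  shows "analytically_conjugate f (linear_part f)"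
proof -
  define \<alpha> where "\<alpha> = 2 * pi * real p / real q"
  define F where "F = (\<lambda>w. I2 (V w))"
  have WV: "W 0 = 0" "V 0 = 0" "real_analytic_at W 0" "real_analytic_at V 0"
    "\<forall>\<^sub>F z in nhds 0. V (W z) = z" "\<forall>\<^sub>F w in nhds 0. W (V w) = w"
    using normal_form unfolding normal_form_coordinates_def analytic_diffeo_germ_def by auto
  obtain \<rho> \<Xi> where \<rho>: "\<rho> > 0"
    and nf: "\<forall>r \<theta>. \<bar>r\<bar> < \<rho> \<longrightarrow> real_analytic2_at \<Xi> r \<theta>"
      "\<forall>r \<theta>. \<bar>r\<bar> < \<rho> \<longrightarrow> \<Xi> r (\<theta> + 2 * pi / real q) = \<Xi> r \<theta>"
      "\<forall>\<theta>. \<Xi> 0 \<theta> = 2 * pi * real p / real q"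
      "\<forall>r \<theta>. 0 \<le> r \<and> r < \<rho> \<longrightarrow>
         W (f (V (of_real r * cis \<theta>))) = of_real r * cis (\<theta> + \<Xi> r \<theta>)"
    using normal_form unfolding normal_form_coordinates_def by (elim conjE exE) (rule that; assumption)
  have f0: "f 0 = 0" "isCont f 0"
    using elliptic differentiable_imp_continuous_within unfolding elliptic_fixed_point_def by auto

  obtain s where s: "s > 0"
    and V_smooth: "smooth_on (\<lambda>z. Re (V z)) {z. \<bar>Re z\<bar> < s \<and> \<bar>Im z\<bar> < s}"
      "smooth_on (\<lambda>z. Im (V z)) {z. \<bar>Re z\<bar> < s \<and> \<bar>Im z\<bar> < s}" (is "smooth_on _ ?Q")
    by (rule real_analytic_at_0_smooth[OF WV(4)]) (rule that)
  have "continuous_on ?Q (\<lambda>z. of_real (Re (V z)) + \<i> * of_real (Im (V z)))"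
    by (intro continuous_intros smooth_on_continuous_on V_smooth)
  then have V_cont: "continuous_on ?Q V" by (simp add: complex_eq[symmetric])
  \<comment> \<open>Restricting to points that \<open>V\<close> sends into \<open>U\<close> makes
    the composite with \<open>I2\<close> smooth on \<open>S\<close>.\<close>
  define S where "S = ?Q \<inter> V -` U"
  have S: "open S" "0 \<in> S"
    using continuous_open_preimage[OF V_cont open_square U(1)] s WV(2) U(2) by (auto simp: S_def)
  have F_smooth: "smooth_on F S"
    unfolding F_def
    by (rule smooth_on_compose[OF S(1) U(1) _ I2(1)])
      (auto simp: S_def intro: smooth_on_subset[OF _ V_smooth(1)] smooth_on_subset[OF _ V_smooth(2)])

  have V_lim: "filterlim V (nhds 0) (nhds 0)"
  proof -
    have "isCont V 0" using V_cont s by (simp add: continuous_on_eq_continuous_at[OF open_square])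
    then show ?thesis using WV(2) tendsto_at_iff_tendsto_nhds[of V 0] by (simp add: isCont_def)
  qed
  have f_lim: "filterlim f (nhds 0) (nhds 0)"
    using f0 tendsto_at_iff_tendsto_nhds[of f 0] by (simp add: isCont_def)
  have fV_lim: "filterlim (\<lambda>w. f (V w)) (nhds 0) (nhds 0)"
    by (rule filterlim_compose[OF f_lim V_lim])
  \<comment> \<open>Near 0 the map \<open>V\<close> undoes \<open>W\<close>, and \<open>I2\<close>
    is preserved by \<open>f\<close>; hence \<open>F\<close> is an integral of \<open>f\<close> read
    in the coordinate.\<close>
  have "\<forall>\<^sub>F w in nhds 0. V (W (f (V w))) = f (V w)"
    by (rule eventually_compose_filterlim[OF WV(5) fV_lim])
  moreover have "\<forall>\<^sub>F w in nhds 0. I2 (f (V w)) = I2 (V w)"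
    by (rule eventually_compose_filterlim[OF I2(2)[unfolded first_integral_def] V_lim])
  ultimately have "\<forall>\<^sub>F w in nhds 0. F (W (f (V w))) = F w"
    by eventually_elim (simp add: F_def)
  then obtain \<delta> where \<delta>: "\<delta> > 0" "\<And>w. cmod w < \<delta> \<Longrightarrow> F (W (f (V w))) = F w"
    unfolding eventually_nhds_metric by auto

  have "\<exists>\<epsilon>>0. \<forall>r \<theta>. 0 \<le> r \<and> r < \<epsilon> \<longrightarrow> \<Xi> r \<theta> = \<alpha>"
    unfolding \<alpha>_def
  \<comment> \<open>The radius is cut down to \<open>\<delta>\<close> because invariance of
    \<open>F\<close> is known only there.\<close>
  proof (rule rotation_of_first_integral[OF S F_smooth, where \<rho> = "min \<rho> \<delta>"])
    show "\<not> taylor_series_in_r2 F" unfolding F_def by (fact I2_taylor)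
    show "F (of_real r * cis (\<theta> + \<Xi> r \<theta>)) = F (of_real r * cis \<theta>)" if "0 \<le> r" "r < min \<rho> \<delta>" for r \<theta>
      using nf(4)[rule_format, of r \<theta>] \<delta>(2)[of "of_real r * cis \<theta>"] that by (simp add: norm_mult)
  qed (use pq \<rho> \<delta>(1) nf(1-3) in auto)
  then obtain \<epsilon> where \<epsilon>: "\<epsilon> > 0" "\<And>r \<theta>. 0 \<le> r \<Longrightarrow> r < \<epsilon> \<Longrightarrow> \<Xi> r \<theta> = \<alpha>" by blast
  \<comment> \<open>In polar form a constant displacement \<open>\<alpha>\<close> is multiplication
    by \<open>cis \<alpha>\<close>, which is the linear part of \<open>f\<close> in the original
    coordinate.\<close>
  have "W (f (V w)) = linear_part f w" if w: "cmod w < min \<rho> \<epsilon>" for w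
  proof -
    have w_eq: "of_real (cmod w) * cis (Arg w) = w"
      using rcis_cmod_Arg[of w] by (simp add: rcis_def)
    have "W (f (V (of_real (cmod w) * cis (Arg w)))) = of_real (cmod w) * cis (Arg w + \<alpha>)"
      using nf(4)[rule_format, of "cmod w" "Arg w"] \<epsilon>(2)[of "cmod w" "Arg w"] w by simp
    also have "\<dots> = cis \<alpha> * (of_real (cmod w) * cis (Arg w))"
      by (simp add: cis_mult[symmetric])
    finally show ?thesis unfolding w_eq linear \<alpha>_def by simp
  qed
  then have "\<forall>\<^sub>F w in nhds 0. W (f (V w)) = linear_part f w"
    unfolding eventually_nhds_metric using \<rho> \<epsilon>(1) by (intro exI[of _ "min \<rho> \<epsilon>"]) auto
  \<comment> \<open>The conjugating map is \<open>V\<close> with inverse \<open>W\<close>, so their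
    roles are exchanged compared with \<open>normal_form\<close>.\<close>
  moreover have "analytic_diffeo_germ V W"
    using WV by (simp add: analytic_diffeo_germ_def)
  ultimately show ?thesis unfolding analytically_conjugate_def by blast
qed

end
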